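(* Let $\mathcal{H}$ be a complex Hilbert space and let $T\in\mathcal{B}(\mathcal{H})$. For $i=1,2$, let $\alpha_i,\beta_i>1$ with $\frac{1}{\alpha_i}+\frac{1}{\beta_i}=1$, and let $f_i,g_i$ be non-negative continuous functions on $[0,\infty)$ such that $f_i(t)g_i(t)=t$ for all $t\in[0,\infty)$. Then $$dw^2(T)\leq\left\|\frac{1}{\alpha_1}f_1^{2\alpha_1}(|T|)+\frac{1}{\beta_1}g_1^{2\beta_1}(|T^*|)+\frac{1}{\alpha_2}f_2^{2\alpha_2}(|T^*T|)+\frac{1}{\beta_2}g_2^{2\beta_2}(|T^*T|)\right\|.$$
   Context: $\mathcal{B}(\mathcal{H})$ is the algebra of bounded linear operators on the complex Hilbert space $\mathcal{H}$, with operator norm $\|\cdot\|$. For $T\in\mathcal{B}(\mathcal{H})$, $|T|=(T^*T)^{1/2}$, and $dw(T)=\sup\{\sqrt{|\langle Tx,x\rangle|^2+\|Tx\|^4}: x\in\mathcal{H},\|x\|=1\}$ is the Davis-Wielandt radius; $dw^2(T)=(dw(T))^2$. For a non-negative continuous function $f$ on $[0,\infty)$, $r>0$ and a positive operator $P$, $f^{r}(P)$ denotes the operator obtained by applying the function $t\mapsto f(t)^{r}$ to $P$ by continuous functional calculus. *)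

theory Defs
  imports "HOL-Analysis.Analysis" "HOL-Computational_Algebra.Polynomial"
begin

class complex_vector = real_vector +
  fixes scaleC :: "complex \<Rightarrow> 'a \<Rightarrow> 'a"  (infixr "*\<^sub>C" 75)
  assumes scaleC_add_right: "c *\<^sub>C (x + y) = c *\<^sub>C x + c *\<^sub>C y"
    and scaleC_add_left: "(c + d) *\<^sub>C x = c *\<^sub>C x + d *\<^sub>C x"
    and scaleC_scaleC: "c *\<^sub>C d *\<^sub>C x = (c * d) *\<^sub>C x"
    and scaleC_one: "1 *\<^sub>C x = x"
    and scaleR_scaleC: "r *\<^sub>R x = complex_of_real r *\<^sub>C x"

text \<open>
  The complex inner product is linear in its first argument. A complex inner product
  space is a real one under \<open>Re \<langle>x, y\<rangle>\<close>; inheriting from \<^class>\<open>real_inner\<close> supplies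
  positive definiteness and \<open>norm x = sqrt (Re \<langle>x, x\<rangle>)\<close>, while \<open>Im \<langle>x, x\<rangle> = 0\<close> follows
  from conjugate symmetry.
\<close>

class complex_inner = complex_vector + real_inner +
  fixes cinner :: "'a \<Rightarrow> 'a \<Rightarrow> complex"
  assumes cinner_commute: "cinner x y = cnj (cinner y x)"
    and cinner_add_left: "cinner (x + y) z = cinner x z + cinner y z"
    and cinner_scaleC_left: "cinner (c *\<^sub>C x) y = c * cinner x y"
    and inner_eq_Re_cinner: "inner x y = Re (cinner x y)"

class chilbert_space = complex_inner + complete_space

text \<open>
  The algebra of bounded operators on a complex Hilbert space is rendered as the
  complex-linear elements of the type of bounded real-linear maps; the norm of that
  type is the operator norm.
\<close>

definition clinear_op :: "('a::complex_inner \<Rightarrow>\<^sub>L 'a) \<Rightarrow> bool" where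
  "clinear_op T \<longleftrightarrow> (\<forall>c x. blinfun_apply T (c *\<^sub>C x) = c *\<^sub>C blinfun_apply T x)"

definition adj :: "('a::chilbert_space \<Rightarrow>\<^sub>L 'a) \<Rightarrow> ('a \<Rightarrow>\<^sub>L 'a)" where
  "adj T = (THE S. \<forall>x y. cinner (blinfun_apply T x) y = cinner x (blinfun_apply S y))"

definition spectrum :: "('a::chilbert_space \<Rightarrow>\<^sub>L 'a) \<Rightarrow> complex set" where
  "spectrum T = {z. \<not> (\<exists>S. clinear_op S \<and>
     (\<forall>x. blinfun_apply S (blinfun_apply T x - z *\<^sub>C x) = x) \<and>
     (\<forall>x. blinfun_apply T (blinfun_apply S x) - z *\<^sub>C blinfun_apply S x = x))}"

definition poly_op :: "real poly \<Rightarrow> ('a::real_normed_vector \<Rightarrow>\<^sub>L 'a) \<Rightarrow> ('a \<Rightarrow>\<^sub>L 'a)" where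
  "poly_op p P = (\<Sum>i\<le>degree p. coeff p i *\<^sub>R (((\<lambda>S. P o\<^sub>L S) ^^ i) id_blinfun))"

text \<open>
  Continuous functional calculus for a self-adjoint operator \<open>P\<close> and a real-valued
  function \<open>f\<close> continuous on the (real, compact) spectrum of \<open>P\<close>: the common norm limit
  of \<open>p\<^sub>n(P)\<close> over all sequences of polynomials \<open>p\<^sub>n\<close> converging to \<open>f\<close> uniformly on the
  spectrum. Such sequences exist by Weierstrass' theorem, which makes the limit unique.
\<close>

definition cfc :: "(real \<Rightarrow> real) \<Rightarrow> ('a::chilbert_space \<Rightarrow>\<^sub>L 'a) \<Rightarrow> ('a \<Rightarrow>\<^sub>L 'a)" where
  "cfc f P = (THE S. \<forall>p :: nat \<Rightarrow> real poly.
     uniform_limit {t. complex_of_real t \<in> spectrum P} (\<lambda>n t. poly (p n) t) f sequentially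
     \<longrightarrow> (\<lambda>n. poly_op (p n) P) \<longlonglongrightarrow> S)"

definition abs_op :: "('a::chilbert_space \<Rightarrow>\<^sub>L 'a) \<Rightarrow> ('a \<Rightarrow>\<^sub>L 'a)" where
  "abs_op T = cfc sqrt (adj T o\<^sub>L T)"

text \<open>
  The values are non-negative, so inserting \<open>0\<close> changes nothing unless the space is
  zero; there it fixes the convention that the supremum over the empty unit sphere is \<open>0\<close>
  (\<^term>\<open>Sup {} :: real\<close> is unspecified).
\<close>

definition dw :: "('a::chilbert_space \<Rightarrow>\<^sub>L 'a) \<Rightarrow> real" where
  "dw T = Sup (insert 0
     {sqrt ((cmod (cinner (blinfun_apply T x) x))\<^sup>2 + norm (blinfun_apply T x) ^ 4) | x. norm x = 1})"

end

theory Submission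
  imports Defs "HOL-Computational_Algebra.Fundamental_Theorem_Algebra"
begin

text \<open>
  For a unit vector \<open>x\<close> the mixed Schwarz inequality bounds \<open>|\<langle>T x, x\<rangle>|\<^sup>2\<close> by
  \<open>\<langle>f\<^sup>2(|T|) x, x\<rangle> \<langle>g\<^sup>2(|T\<^sup>*|) x, x\<rangle>\<close>; Young's inequality followed by McCarthy's inequality turns the
  product into \<open>\<langle>(f\<^bsup>2\<alpha>\<^esup>(|T|)/\<alpha> + g\<^bsup>2\<beta>\<^esup>(|T\<^sup>*|)/\<beta>) x, x\<rangle>\<close>. The same bound for the self-adjoint
  operator \<open>T\<^sup>* T\<close> controls \<open>\<parallel>T x\<parallel>\<^sup>4 = \<langle>T\<^sup>* T x, x\<rangle>\<^sup>2\<close>, and the sum of the two quadratic forms is at most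
  the norm. The functional calculus rests on \<open>\<parallel>p(P)\<parallel> \<le> sup |p|\<close> over the spectrum: if
  \<open>n = \<parallel>p(P)\<parallel>\<close>, then \<open>p(P) - n\<close> or \<open>p(P) + n\<close> is not invertible, and factoring \<open>p \<mp> n\<close> into real
  linear and quadratic factors produces a spectral point \<open>t\<close> with \<open>|p(t)| = n\<close>.
\<close>

section \<open>Riesz representation\<close>

lemma inner_eqI:
  fixes a b :: "'a::real_inner"
  assumes "\<And>x. inner x a = inner x b"
  shows "a = b"
proof -
  have "inner (a - b) (a - b) = 0"
    using assms[of "a - b"] by (simp add: inner_diff_right)
  then show ?thesis by simp
qed

text \<open>The parallelogram law, arranged so that almost minimal values at \<open>a\<close> and
  \<open>b\<close> force \<open>a - b\<close> to be small.\<close>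

lemma parallelogram_midpoint:
  fixes a b :: "'a::real_inner"
  shows "(norm ((1/2) *\<^sub>R (a + b)))\<^sup>2 = ((norm a)\<^sup>2 + (norm b)\<^sup>2) / 2 - (norm (a - b))\<^sup>2 / 4"
  by (simp only: power2_norm_eq_inner)
    (simp add: inner_add_left inner_add_right inner_diff_left inner_diff_right
      inner_commute[of b a] field_simps)

text \<open>The representing vector minimises \<open>\<parallel>x\<parallel>\<^sup>2 - 2 \<phi> x\<close>.\<close>

lemma Riesz_representation:
  fixes \<phi> :: "'a::{real_inner,complete_space} \<Rightarrow> real"
  assumes "bounded_linear \<phi>"
  obtains z where "\<And>x. \<phi> x = inner x z"
proof -
  interpret bounded_linear \<phi> by fact
  define J where "J x = (norm x)\<^sup>2 - 2 * \<phi> x" for x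
  obtain K where K: "\<And>x. norm (\<phi> x) \<le> norm x * K"
    using bounded by blast
  have "- K\<^sup>2 \<le> J x" for x
  proof -
    have "\<phi> x \<le> norm x * K" using K[of x] by simp
    moreover have "0 \<le> (norm x - K)\<^sup>2" by simp
    ultimately show ?thesis
      unfolding J_def by (simp add: power2_eq_square algebra_simps)
  qed
  then have bdd: "bdd_below (range J)" by (intro bdd_belowI2)
  define m where "m = Inf (range J)"
  have m_le: "m \<le> J x" for x
    unfolding m_def using bdd by (simp add: cINF_lower)
  have "\<exists>x. J x < m + 1 / Suc n" for n
  proof (rule ccontr)
    assume "\<nexists>x. J x < m + 1 / Suc n"
    then have "m + 1 / Suc n \<le> m"
      unfolding m_def by (intro cINF_greatest) (auto simp: not_less)
    moreover have "0 < 1 / real (Suc n)" by simp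
    ultimately show False by linarith
  qed
  then obtain X where X: "\<And>n. J (X n) < m + 1 / Suc n" by metis
  \<comment> \<open>As \<open>\<phi>\<close> is linear, \<open>J\<close> at the midpoint is the mean
    of \<open>J a\<close> and \<open>J b\<close> minus a quarter of the squared distance, and it is
    still at least \<open>m\<close>.\<close>
  have mid: "(norm (a - b))\<^sup>2 \<le> 2 * (J a - m) + 2 * (J b - m)" for a b
    using m_le[of "(1/2) *\<^sub>R (a + b)"] unfolding J_def parallelogram_midpoint scaleR add
    by (simp add: field_simps)
  have "Cauchy X"
  proof (rule metric_CauchyI)
    fix e :: real assume e: "0 < e"
    then obtain N where N: "1 / Suc N < e\<^sup>2 / 4"
      using nat_approx_posE[of "e\<^sup>2/4"] by auto
    have J: "J (X n) - m < e\<^sup>2 / 4" if "n \<ge> N" for n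
    proof -
      have "1 / real (Suc n) \<le> 1 / real (Suc N)" using that by (simp add: frac_le)
      then show ?thesis using X[of n] N by linarith
    qed
    have "dist (X i) (X j) < e" if "i \<ge> N" "j \<ge> N" for i j
    proof -
      have "(norm (X i - X j))\<^sup>2 < e\<^sup>2"
        using mid[of "X i" "X j"] J[OF that(1)] J[OF that(2)] by simp
      then show ?thesis
        using e by (simp add: dist_norm power_less_imp_less_base)
    qed
    then show "\<exists>M. \<forall>i\<ge>M. \<forall>j\<ge>M. dist (X i) (X j) < e" by blast
  qed
  then obtain z where z: "X \<longlonglongrightarrow> z"
    using Cauchy_convergent convergent_def by blast
  have "(\<lambda>n. J (X n)) \<longlonglongrightarrow> J z"
    unfolding J_def using z by (intro tendsto_intros tendsto)
  moreover have "(\<lambda>n. m + 1 / Suc n) \<longlonglongrightarrow> m + 0"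
    by (intro tendsto_intros LIMSEQ_inverse_real_of_nat[unfolded inverse_eq_divide])
  ultimately have Jz: "J z \<le> m"
    using X by (intro LIMSEQ_le[where X="\<lambda>n. J (X n)" and Y="\<lambda>n. m + 1 / Suc n"])
      (auto intro: less_imp_le)
  have "\<phi> x = inner x z" for x
  proof (cases "x = 0")
    case False
    define d where "d = \<phi> x - inner x z"
    \<comment> \<open>This \<open>t\<close> minimises
      \<open>- 2 * t * d + t\<^sup>2 * (norm x)\<^sup>2\<close>, the change of \<open>J\<close> in
      direction \<open>x\<close>. The drop it yields must vanish because \<open>z\<close> is already
      a minimiser.\<close>
    define t where "t = d / (norm x)\<^sup>2"
    have "J z \<le> J (z + t *\<^sub>R x)" using Jz m_le order_trans by blast
    moreover have "J (z + t *\<^sub>R x) = J z - 2 * t * d + t\<^sup>2 * (norm x)\<^sup>2"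
      unfolding J_def d_def
      by (simp only: power2_norm_eq_inner)
        (simp add: add scaleR inner_add_left inner_add_right inner_commute power2_eq_square algebra_simps)
    moreover have "- 2 * t * d + t\<^sup>2 * (norm x)\<^sup>2 = - d\<^sup>2 / (norm x)\<^sup>2"
      using False by (simp add: t_def field_simps power2_eq_square)
    ultimately have "d\<^sup>2 / (norm x)\<^sup>2 \<le> 0" by simp
    then have "d = 0" using False by (simp add: divide_le_0_iff)
    then show ?thesis by (simp add: d_def)
  qed (simp add: zero)
  then show thesis by (rule that)
qed

text \<open>Riesz applied to each functional \<open>inner (T x) y\<close>. Representing vectors are
  unique, hence linear in \<open>y\<close>, and testing against \<open>s y\<close> itself bounds
  them by \<open>norm T\<close>.\<close>

lemma real_adjoint_exists:
  fixes T :: "'a::{real_inner,complete_space} \<Rightarrow>\<^sub>L 'a"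
  obtains S :: "'a \<Rightarrow>\<^sub>L 'a" where "\<And>x y. inner (T x) y = inner x (S y)"
proof -
  have "\<exists>z. \<forall>x. inner (T x) y = inner x z" for y
  proof -
    have "bounded_linear (\<lambda>x. inner (T x) y)"
      by (intro bounded_linear_intros)
    then show ?thesis using Riesz_representation by metis
  qed
  then obtain s where s: "\<And>x y. inner (T x) y = inner x (s y)" by metis
  have "bounded_linear s"
  proof (rule bounded_linear_intro[where K="norm T"])
    show "s (x + y) = s x + s y" for x y
      by (rule inner_eqI) (metis inner_add_right s)
    show "s (r *\<^sub>R x) = r *\<^sub>R s x" for r x
      by (rule inner_eqI) (metis inner_scaleR_right s)
    show "norm (s y) \<le> norm y * norm T" for y
    proof (cases "s y = 0")
      case False
      have "norm (s y) * norm (s y) = inner (T (s y)) y"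
        by (simp add: s flip: power2_eq_square power2_norm_eq_inner)
      also have "\<dots> \<le> norm (T (s y)) * norm y" by (rule norm_cauchy_schwarz)
      also have "\<dots> \<le> (norm T * norm (s y)) * norm y"
        by (intro mult_right_mono norm_blinfun) auto
      finally show ?thesis using False by (simp add: mult.commute mult.left_commute)
    qed simp
  qed
  then show thesis
    using that[of "Blinfun s"] s by (simp add: bounded_linear_Blinfun_apply)
qed

section \<open>Invertible and symmetric operators\<close>

text \<open>The inverse need only be bounded and real-linear, so that arguments in real Hilbert
  space apply; \<open>spectrum_real_iff\<close> reconciles this with the complex spectrum.\<close>

definition invertible_op :: "('a::real_normed_vector \<Rightarrow>\<^sub>L 'a) \<Rightarrow> bool" where
  "invertible_op A \<longleftrightarrow> (\<exists>S. A o\<^sub>L S = id_blinfun \<and> S o\<^sub>L A = id_blinfun)"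

definition symmetric_op :: "('a::real_inner \<Rightarrow>\<^sub>L 'a) \<Rightarrow> bool" where
  "symmetric_op A \<longleftrightarrow> (\<forall>x y. inner (A x) y = inner x (A y))"

lemma blinfun_compose_assoc: "(A o\<^sub>L B) o\<^sub>L C = A o\<^sub>L (B o\<^sub>L C)"
  by (rule blinfun_eqI) simp

lemma blinfun_compose_id [simp]: "A o\<^sub>L id_blinfun = A" "id_blinfun o\<^sub>L A = A"
  by (rule blinfun_eqI, simp)+

lemmas blinfun_compose_simps =
  bounded_bilinear.add_left[OF bounded_bilinear_blinfun_compose]
  bounded_bilinear.add_right[OF bounded_bilinear_blinfun_compose]
  bounded_bilinear.diff_left[OF bounded_bilinear_blinfun_compose]
  bounded_bilinear.diff_right[OF bounded_bilinear_blinfun_compose]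
  bounded_bilinear.scaleR_left[OF bounded_bilinear_blinfun_compose]
  bounded_bilinear.scaleR_right[OF bounded_bilinear_blinfun_compose]
  bounded_bilinear.sum_left[OF bounded_bilinear_blinfun_compose]
  bounded_bilinear.sum_right[OF bounded_bilinear_blinfun_compose]

lemma invertible_op_compose:
  assumes "invertible_op A" "invertible_op B"
  shows "invertible_op (A o\<^sub>L B)"
proof -
  obtain S R where "A o\<^sub>L S = id_blinfun" "S o\<^sub>L A = id_blinfun"
    "B o\<^sub>L R = id_blinfun" "R o\<^sub>L B = id_blinfun"
    using assms unfolding invertible_op_def by blast
  then have "A (S x) = x" "S (A x) = x" "B (R x) = x" "R (B x) = x" for x
    by (metis blinfun_apply_blinfun_compose blinfun_apply_id_blinfun)+
  then have "(A o\<^sub>L B) o\<^sub>L (R o\<^sub>L S) = id_blinfun" "(R o\<^sub>L S) o\<^sub>L (A o\<^sub>L B) = id_blinfun"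
    by (auto intro: blinfun_eqI)
  then show ?thesis unfolding invertible_op_def by blast
qed

lemma invertible_op_scaleR:
  assumes "invertible_op A" "c \<noteq> 0"
  shows "invertible_op (c *\<^sub>R A)"
proof -
  obtain S where "A o\<^sub>L S = id_blinfun" "S o\<^sub>L A = id_blinfun"
    using assms unfolding invertible_op_def by blast
  then show ?thesis
    using assms(2) unfolding invertible_op_def
    by (intro exI[of _ "inverse c *\<^sub>R S"]) (simp add: blinfun_compose_simps)
qed

lemma invertible_op_id: "invertible_op id_blinfun"
  unfolding invertible_op_def by (intro exI[of _ id_blinfun]) simp

text \<open>For coercive \<open>A\<close> and small \<open>\<tau> > 0\<close> the map \<open>x \<mapsto> x - \<tau> (A x - y)\<close> is a contraction.\<close>

lemma coercive_solvable:
  fixes A :: "'a::{real_inner,complete_space} \<Rightarrow>\<^sub>L 'a"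
  assumes c: "c > 0" and coercive: "\<And>x. c * (norm x)\<^sup>2 \<le> inner (A x) x"
  shows "\<exists>x. A x = y"
proof -
  define M where "M = norm A + c"
  \<comment> \<open>Since \<open>M\<close> dominates \<open>norm A\<close> and \<open>c\<close>, the
    quadratic term \<open>\<tau>\<^sup>2 * (norm (A x))\<^sup>2\<close> costs at most half of the
    gain \<open>2 * \<tau> * c * (norm x)\<^sup>2\<close> from coercivity, and
    \<open>1 - \<tau> * c\<close> stays non-negative.\<close>
  define \<tau> where "\<tau> = c / M\<^sup>2"
  define q where "q = sqrt (1 - \<tau> * c)"
  have M: "M > 0" "c \<le> M" using c by (auto simp: M_def add_nonneg_pos)
  have \<tau>: "\<tau> > 0" using c M by (simp add: \<tau>_def)
  have tc: "\<tau> * c > 0" "\<tau> * c \<le> 1"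
    using c M \<tau> by (auto simp: \<tau>_def power2_eq_square divide_le_eq intro!: mult_mono)
  have q: "0 \<le> q" "q < 1" using tc by (auto simp: q_def)
  have contr: "norm (x - \<tau> *\<^sub>R A x) \<le> q * norm x" for x
  proof -
    have "norm (A x) \<le> M * norm x"
      using norm_blinfun[of A x] c by (smt (verit) M_def mult_right_mono norm_ge_zero)
    then have "(norm (A x))\<^sup>2 \<le> (M * norm x)\<^sup>2" by (rule power_mono) simp
    then have "\<tau>\<^sup>2 * (norm (A x))\<^sup>2 \<le> \<tau>\<^sup>2 * (M * norm x)\<^sup>2"
      by (rule mult_left_mono) simp
    also have "\<dots> = \<tau> * c * (norm x)\<^sup>2"
      using M by (simp add: \<tau>_def power2_eq_square)
    finally have 1: "\<tau>\<^sup>2 * (norm (A x))\<^sup>2 \<le> \<tau> * c * (norm x)\<^sup>2" .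
    have "\<tau> * (c * (norm x)\<^sup>2) \<le> \<tau> * inner (A x) x"
      using coercive \<tau> by (intro mult_left_mono) auto
    moreover have "(norm (x - \<tau> *\<^sub>R A x))\<^sup>2
        = (norm x)\<^sup>2 - 2 * (\<tau> * inner (A x) x) + \<tau>\<^sup>2 * (norm (A x))\<^sup>2"
      by (simp only: power2_norm_eq_inner)
        (simp add: inner_diff_left inner_diff_right inner_commute power2_eq_square)
    ultimately have "(norm (x - \<tau> *\<^sub>R A x))\<^sup>2 \<le> (1 - \<tau> * c) * (norm x)\<^sup>2"
      using 1 by (simp add: algebra_simps)
    also have "\<dots> = (q * norm x)\<^sup>2"
      using tc by (simp add: q_def power_mult_distrib)
    finally show ?thesis
      using q by (meson mult_nonneg_nonneg norm_ge_zero power2_le_imp_le)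
  qed
  have "\<exists>!x. x - \<tau> *\<^sub>R (A x - y) = x"
  proof (rule banach_fix_type[OF q], intro allI)
    fix u v
    have "u - \<tau> *\<^sub>R (A u - y) - (v - \<tau> *\<^sub>R (A v - y)) = (u - v) - \<tau> *\<^sub>R A (u - v)"
      by (simp add: blinfun.diff_right scaleR_diff_right)
    then show "dist (u - \<tau> *\<^sub>R (A u - y)) (v - \<tau> *\<^sub>R (A v - y)) \<le> q * dist u v"
      unfolding dist_norm using contr[of "u - v"] by (simp only:)
  qed
  then show ?thesis using \<tau> by auto
qed

text \<open>A Lax-Milgram argument: coercivity and Cauchy-Schwarz give
  \<open>c * norm x \<le> norm (A x)\<close>, so \<open>A\<close> is injective, and the solution map
  of \<open>coercive_solvable\<close> is linear and bounded by \<open>1 / c\<close>.\<close>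

lemma coercive_invertible_op:
  fixes A :: "'a::{real_inner,complete_space} \<Rightarrow>\<^sub>L 'a"
  assumes c: "c > 0" and coercive: "\<And>x. c * (norm x)\<^sup>2 \<le> inner (A x) x"
  shows "invertible_op A"
proof -
  obtain s where s: "\<And>y. A (s y) = y"
    using coercive_solvable[OF c coercive] by metis
  have below: "c * norm x \<le> norm (A x)" for x
  proof (cases "x = 0")
    case False
    have "c * norm x * norm x \<le> norm (A x) * norm x"
      using coercive[of x] norm_cauchy_schwarz[of "A x" x]
      by (simp add: power2_eq_square mult.assoc)
    then show ?thesis using False by simp
  qed simp
  have inj: "u = v" if "A u = A v" for u v
    using below[of "u - v"] that c by (simp add: blinfun.diff_right mult_le_0_iff)
  have "bounded_linear s"
  proof (rule bounded_linear_intro[where K="inverse c"])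
    show "s (x + y) = s x + s y" for x y
      by (rule inj) (simp add: s blinfun.add_right)
    show "s (r *\<^sub>R x) = r *\<^sub>R s x" for r x
      by (rule inj) (simp add: s blinfun.scaleR_right)
    show "norm (s y) \<le> norm y * inverse c" for y
      using below[of "s y"] c by (simp add: s field_simps)
  qed
  then have app: "Blinfun s y = s y" for y by (simp add: bounded_linear_Blinfun_apply)
  have "A o\<^sub>L Blinfun s = id_blinfun"
    by (rule blinfun_eqI) (simp add: app s)
  moreover have "Blinfun s o\<^sub>L A = id_blinfun"
    by (rule blinfun_eqI, rule inj) (simp add: app s)
  ultimately show ?thesis unfolding invertible_op_def by blast
qed

text \<open>Unit vectors \<open>x\<close> with \<open>\<parallel>A x\<parallel>\<close> close to \<open>\<parallel>A\<parallel>\<close> are almost annihilated by \<open>A\<^sup>2 - \<parallel>A\<parallel>\<^sup>2\<close>.\<close>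

lemma symmetric_op_norm_in_spectrum:
  fixes A :: "'a::real_inner \<Rightarrow>\<^sub>L 'a"
  assumes sym: "symmetric_op A"
    and inv: "invertible_op (A - norm A *\<^sub>R id_blinfun)" "invertible_op (A + norm A *\<^sub>R id_blinfun)"
  shows "A = 0"
proof (rule ccontr)
  assume "A \<noteq> 0"
  define n where "n = norm A"
  have n: "n > 0" using \<open>A \<noteq> 0\<close> by (simp add: n_def)
  define B where "B = (A - n *\<^sub>R id_blinfun) o\<^sub>L (A + n *\<^sub>R id_blinfun)"
  obtain S where S: "S o\<^sub>L B = id_blinfun"
    using invertible_op_compose[OF inv] unfolding invertible_op_def B_def n_def by blast
  \<comment> \<open>The summand 1 makes \<open>C\<close> positive without a case distinction on
    \<open>S\<close>.\<close>
  define C where "C = norm S + 1"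
  have C: "C > 0" by (simp add: C_def add_nonneg_pos)
  have below: "norm x \<le> C * norm (B x)" for x
  proof -
    have "x = S (B x)" by (metis S blinfun_apply_blinfun_compose blinfun_apply_id_blinfun id_apply)
    also have "norm \<dots> \<le> norm S * norm (B x)" by (rule norm_blinfun)
    also have "\<dots> \<le> C * norm (B x)" by (intro mult_right_mono) (auto simp: C_def)
    finally show ?thesis .
  qed
  \<comment> \<open>The reciprocal of the constant in \<open>(norm x)\<^sup>2 \<le> 2 * C\<^sup>2 *
    n\<^sup>2 * (n\<^sup>2 * (norm x)\<^sup>2 - (norm (A x))\<^sup>2)\<close>: since
    \<open>B\<close> is bounded below, \<open>norm (A x)\<close> stays uniformly away from
    \<open>n * norm x\<close>.\<close>
  define \<delta> where "\<delta> = 1 / (2 * C\<^sup>2 * n\<^sup>2)"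
  have \<delta>: "\<delta> > 0" using C n by (simp add: \<delta>_def)
  have key: "(norm (A x))\<^sup>2 \<le> (n\<^sup>2 - \<delta>) * (norm x)\<^sup>2" for x
  proof -
    have B: "B x = A (A x) - n\<^sup>2 *\<^sub>R x"
      by (simp add: B_def blinfun.add_left blinfun.add_right blinfun.diff_left
          blinfun.scaleR_left blinfun.scaleR_right power2_eq_square scaleR_diff_right)
    have "(norm (B x))\<^sup>2 = (norm (A (A x)))\<^sup>2 - 2 * n\<^sup>2 * inner (A (A x)) x + n^4 * (norm x)\<^sup>2"
      unfolding B by (simp only: power2_norm_eq_inner)
        (simp add: inner_diff_left inner_diff_right inner_commute power2_eq_square power4_eq_xxxx)
    moreover have "inner (A (A x)) x = (norm (A x))\<^sup>2"
      using sym by (simp add: symmetric_op_def power2_norm_eq_inner)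
    moreover have "(norm (A (A x)))\<^sup>2 \<le> n\<^sup>2 * (norm (A x))\<^sup>2"
      using power_mono[OF norm_blinfun[of A "A x"], of 2] by (simp add: n_def power_mult_distrib)
    moreover have "n\<^sup>2 * (norm (A x))\<^sup>2 \<le> n^4 * (norm x)\<^sup>2"
    proof -
      have "(norm (A x))\<^sup>2 \<le> n\<^sup>2 * (norm x)\<^sup>2"
        using power_mono[OF norm_blinfun[of A x], of 2] by (simp add: n_def power_mult_distrib)
      then have "n\<^sup>2 * (norm (A x))\<^sup>2 \<le> n\<^sup>2 * (n\<^sup>2 * (norm x)\<^sup>2)" by (rule mult_left_mono) simp
      then show ?thesis by (simp add: power2_eq_square power4_eq_xxxx mult.assoc)
    qed
    ultimately have "(norm (B x))\<^sup>2 \<le> 2 * n^4 * (norm x)\<^sup>2 - 2 * n\<^sup>2 * (norm (A x))\<^sup>2" by simp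
    then have b: "(norm (B x))\<^sup>2 \<le> 2 * n\<^sup>2 * (n\<^sup>2 * (norm x)\<^sup>2 - (norm (A x))\<^sup>2)"
      by (simp add: algebra_simps power2_eq_square power4_eq_xxxx)
    have "(norm x)\<^sup>2 \<le> C\<^sup>2 * (norm (B x))\<^sup>2"
      using power_mono[OF below[of x], of 2] by (simp add: power_mult_distrib)
    also have "\<dots> \<le> C\<^sup>2 * (2 * n\<^sup>2 * (n\<^sup>2 * (norm x)\<^sup>2 - (norm (A x))\<^sup>2))"
      using b by (rule mult_left_mono) simp
    finally have "\<delta> * (norm x)\<^sup>2 \<le> n\<^sup>2 * (norm x)\<^sup>2 - (norm (A x))\<^sup>2"
      using C n by (simp add: \<delta>_def pos_divide_le_eq mult_ac)
    then show ?thesis by (simp add: algebra_simps)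
  qed
  \<comment> \<open>The \<open>max\<close> covers \<open>\<delta> > n\<^sup>2\<close>, where the
    root would be taken of a negative number; in either case \<open>r < n\<close>.\<close>
  define r where "r = sqrt (max 0 (n\<^sup>2 - \<delta>))"
  have "norm A \<le> r"
  proof (rule norm_blinfun_bound)
    show "norm (A x) \<le> r * norm x" for x
    proof (rule power2_le_imp_le)
      have "(norm (A x))\<^sup>2 \<le> max 0 (n\<^sup>2 - \<delta>) * (norm x)\<^sup>2"
        using key[of x] by (rule order_trans) (intro mult_right_mono, auto)
      then show "(norm (A x))\<^sup>2 \<le> (r * norm x)\<^sup>2"
        by (simp add: r_def power_mult_distrib)
    qed (simp add: r_def)
  qed (simp add: r_def)
  moreover have "r < n"
  proof -
    have "r < sqrt (n\<^sup>2)" unfolding r_def using \<delta> n by (intro real_sqrt_less_mono) auto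
    then show ?thesis using n by simp
  qed
  ultimately show False by (simp add: n_def)
qed

section \<open>Polynomials of a symmetric operator\<close>

lemma symmetric_op_add: "symmetric_op A \<Longrightarrow> symmetric_op B \<Longrightarrow> symmetric_op (A + B)"
  by (simp add: symmetric_op_def blinfun.add_left inner_add_left inner_add_right)

lemma symmetric_op_scaleR: "symmetric_op A \<Longrightarrow> symmetric_op (c *\<^sub>R A)"
  by (simp add: symmetric_op_def blinfun.scaleR_left)

lemma symmetric_op_id: "symmetric_op id_blinfun"
  by (simp add: symmetric_op_def)

lemma symmetric_op_compose:
  "symmetric_op A \<Longrightarrow> symmetric_op B \<Longrightarrow> A o\<^sub>L B = B o\<^sub>L A \<Longrightarrow> symmetric_op (A o\<^sub>L B)"
  unfolding symmetric_op_def by (metis blinfun_apply_blinfun_compose)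

text \<open>Padding with zero coefficients detaches the sum from \<open>degree\<close>, since
  \<open>pCons a p\<close> does not always have degree \<open>Suc (degree p)\<close>.\<close>

lemma poly_op_eq_sum:
  assumes "degree p \<le> n"
  shows "poly_op p P = (\<Sum>i\<le>n. coeff p i *\<^sub>R (((\<lambda>S. P o\<^sub>L S) ^^ i) id_blinfun))"
  unfolding poly_op_def using assms
  by (intro sum.mono_neutral_left) (auto simp: coeff_eq_0)

lemma poly_op_0 [simp]: "poly_op 0 P = 0"
  by (simp add: poly_op_def)

text \<open>Horner's rule, the recursion behind the inductions on \<open>poly_op\<close>.\<close>

lemma poly_op_pCons [simp]: "poly_op (pCons a p) P = a *\<^sub>R id_blinfun + (P o\<^sub>L poly_op p P)"
proof -
  have "poly_op (pCons a p) P
      = (\<Sum>i\<le>Suc (degree p). coeff (pCons a p) i *\<^sub>R (((\<lambda>S. P o\<^sub>L S) ^^ i) id_blinfun))"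
    by (rule poly_op_eq_sum) (simp add: degree_pCons_le)
  then show ?thesis
    by (simp add: sum.atMost_Suc_shift poly_op_def blinfun_compose_simps del: sum.atMost_Suc)
qed

lemma poly_op_add: "poly_op (p + q) P = poly_op p P + poly_op q P"
  by (induction p q rule: poly_induct2)
    (simp_all add: blinfun_compose_simps scaleR_left_distrib)

lemma poly_op_smult: "poly_op (smult c p) P = c *\<^sub>R poly_op p P"
  by (induction p rule: pCons_induct) (simp_all add: blinfun_compose_simps scaleR_right_distrib)

lemma poly_op_diff: "poly_op (p - q) P = poly_op p P - poly_op q P"
  using poly_op_add[of p "- q" P] poly_op_smult[of "-1" q P] by simp

lemma poly_op_mult: "poly_op (p * q) P = poly_op p P o\<^sub>L poly_op q P"
  by (induction p rule: pCons_induct)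
    (simp_all add: poly_op_add poly_op_smult blinfun_compose_simps blinfun_compose_assoc)

text \<open>With \<open>T\<close>, \<open>A\<close> and \<open>B\<close> all equal to
  \<open>P\<close> this says that \<open>P\<close> commutes with its polynomials; the general form
  later links \<open>adj T o\<^sub>L T\<close> with \<open>T o\<^sub>L adj T\<close>.\<close>

lemma poly_op_intertwine:
  assumes "T o\<^sub>L A = B o\<^sub>L T"
  shows "T o\<^sub>L poly_op p A = poly_op p B o\<^sub>L T"
proof (induction p rule: pCons_induct)
  case (pCons a p)
  have "T o\<^sub>L (A o\<^sub>L poly_op p A) = B o\<^sub>L (poly_op p B o\<^sub>L T)"
    by (metis assms blinfun_compose_assoc pCons.IH)
  then show ?case by (simp add: blinfun_compose_simps blinfun_compose_assoc)
qed simp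

lemma symmetric_op_poly_op: "symmetric_op P \<Longrightarrow> symmetric_op (poly_op p P)"
proof (induction p rule: pCons_induct)
  case (pCons a p)
  then show ?case
    by (simp add: symmetric_op_add symmetric_op_scaleR symmetric_op_id symmetric_op_compose
        poly_op_intertwine)
qed (simp add: symmetric_op_def)

section \<open>Real polynomials: factorization and invertibility\<close>

lemma poly_map_of_real_add:
  "poly (map_poly of_real (p + q)) z = poly (map_poly of_real p) z + (poly (map_poly of_real q) z :: complex)"
  by (induction p q rule: poly_induct2) (simp_all add: map_poly_pCons algebra_simps)

lemma poly_map_of_real_smult:
  "poly (map_poly of_real (smult c p)) z = of_real c * (poly (map_poly of_real p) z :: complex)"
  by (induction p rule: pCons_induct) (simp_all add: map_poly_pCons algebra_simps)

lemma poly_map_of_real_mult: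
  "poly (map_poly of_real (p * q)) z = poly (map_poly of_real p) z * (poly (map_poly of_real q) z :: complex)"
  by (induction p rule: pCons_induct)
    (simp_all add: map_poly_pCons poly_map_of_real_add poly_map_of_real_smult algebra_simps)

text \<open>Take a complex root \<open>z\<close>. If it is real, it gives the linear factor.
  Otherwise let \<open>d\<close> be the real polynomial with roots \<open>z\<close> and
  \<open>cnj z\<close>: the remainder of \<open>q\<close> modulo \<open>d\<close> has degree below 2
  and vanishes at the non-real \<open>z\<close>, so it is zero.\<close>

lemma real_poly_factor:
  fixes q :: "real poly"
  assumes "degree q > 0"
  obtains (linear) a r where "q = [:-a, 1:] * r"
  | (quadratic) a b r where "b \<noteq> 0" "q = [:a\<^sup>2 + b\<^sup>2, -2 * a, 1:] * r"
proof -
  define Q where "Q = (map_poly of_real q :: complex poly)"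
  have "degree Q = degree q" unfolding Q_def by (rule degree_map_poly) simp
  then have "\<not> (\<exists>a l. a \<noteq> 0 \<and> l = 0 \<and> Q = pCons a l)" using assms by auto
  then obtain z where z: "poly Q z = 0" using fundamental_theorem_of_algebra_alt by blast
  show thesis
  proof (cases "Im z = 0")
    case True
    then have "z = of_real (Re z)" by (simp add: complex_eq_iff)
    moreover have "poly Q (of_real t) = of_real (poly q t)" for t
      unfolding Q_def by (induction q rule: pCons_induct) (simp_all add: map_poly_pCons)
    ultimately have "poly q (Re z) = 0" using z by (metis of_real_eq_0_iff)
    then show thesis using linear by (auto simp: poly_eq_0_iff_dvd dvd_def)
  next
    case False
    define d where "d = [:(Re z)\<^sup>2 + (Im z)\<^sup>2, -2 * Re z, 1:]"
    define r where "r = q mod d"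
    have d: "poly (map_poly of_real d) z = (0 :: complex)"
      by (simp add: d_def map_poly_pCons complex_eq_iff power2_eq_square algebra_simps)
    have "q = (q div d) * d + r" by (simp add: r_def)
    then have "poly (map_poly of_real r) z = (0 :: complex)"
      using z d by (metis Q_def add_0 mult_zero_right poly_map_of_real_add poly_map_of_real_mult)
    moreover have "degree r < 2"
      using degree_mod_less'[of d q] by (cases "r = 0") (auto simp: r_def d_def)
    then have r: "r = [:coeff r 0, coeff r 1:]"
      by (intro poly_eqI) (auto simp: coeff_pCons coeff_eq_0 split: nat.split)
    ultimately have "of_real (coeff r 0) + z * of_real (coeff r 1) = 0"
      by (subst (asm) r) (simp add: map_poly_pCons)
    then have "coeff r 0 + Re z * coeff r 1 = 0" "Im z * coeff r 1 = 0"
      by (simp_all add: complex_eq_iff)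
    then have "r = 0" using False by (subst r) simp
    then have "q = d * (q div d)" by (metis add_0_right mult_div_mod_eq r_def)
    then show thesis using quadratic[OF False] unfolding d_def by blast
  qed
qed

text \<open>Induction on the degree, splitting off one factor at a time. A linear factor belongs to
  a root and is invertible by assumption; a quadratic one is
  \<open>(P - a)\<^sup>2 + b\<^sup>2\<close>, which is coercive with constant
  \<open>b\<^sup>2\<close> because \<open>P\<close> is symmetric.\<close>

lemma invertible_op_poly_op:
  fixes P :: "'a::{real_inner,complete_space} \<Rightarrow>\<^sub>L 'a"
  assumes "symmetric_op P" "q \<noteq> 0"
    and "\<And>t. poly q t = 0 \<Longrightarrow> invertible_op (P - t *\<^sub>R id_blinfun)"
  shows "invertible_op (poly_op q P)"
  using assms(2,3)
proof (induction "degree q" arbitrary: q rule: less_induct)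
  case less
  show ?case
  proof (cases "degree q = 0")
    case True
    then obtain c where "q = [:c:]" by (metis degree_eq_zeroE)
    with \<open>q \<noteq> 0\<close> show ?thesis by (simp add: invertible_op_scaleR invertible_op_id blinfun_compose_simps)
  next
    case False
    then have "degree q > 0" by simp
    then show ?thesis
    proof (cases rule: real_poly_factor)
      case (linear a r)
      then have "r \<noteq> 0" using \<open>q \<noteq> 0\<close> by auto
      moreover from this have "degree r < degree q"
        unfolding linear by (subst degree_mult_eq) auto
      ultimately have "invertible_op (poly_op r P)"
        using less.hyps[of r] less.prems(2) linear by simp
      moreover have "invertible_op (poly_op [:-a, 1:] P)"
        using less.prems(2)[of a] linear by simp
      ultimately show ?thesis
        using linear by (simp only: poly_op_mult invertible_op_compose)
    next
      case (quadratic a b r)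
      then have "r \<noteq> 0" using \<open>q \<noteq> 0\<close> by auto
      moreover from this have "degree r < degree q"
        unfolding quadratic(2) by (subst degree_mult_eq) auto
      ultimately have r: "r \<noteq> 0" "degree r < degree q" .
      have "invertible_op (poly_op [:a\<^sup>2 + b\<^sup>2, -2 * a, 1:] P)"
      proof (rule coercive_invertible_op[of "b\<^sup>2"])
        show "b\<^sup>2 > 0" using quadratic by simp
        show "b\<^sup>2 * (norm x)\<^sup>2 \<le> inner (poly_op [:a\<^sup>2 + b\<^sup>2, -2 * a, 1:] P x) x" for x
        proof -
          have d: "poly_op [:a\<^sup>2 + b\<^sup>2, -2 * a, 1:] P x = (a\<^sup>2 + b\<^sup>2) *\<^sub>R x - (2 * a) *\<^sub>R P x + P (P x)"
            by (simp add: blinfun.add_left blinfun.add_right blinfun.diff_left blinfun.diff_right blinfun.scaleR_left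
                blinfun.scaleR_right blinfun.minus_left blinfun.minus_right)
          have PP: "inner (P (P x)) x = inner (P x) (P x)"
            using assms(1) by (simp add: symmetric_op_def)
          have "inner (poly_op [:a\<^sup>2 + b\<^sup>2, -2 * a, 1:] P x) x
              = (norm (P x - a *\<^sub>R x))\<^sup>2 + b\<^sup>2 * (norm x)\<^sup>2"
            unfolding d power2_norm_eq_inner
            by (simp add: PP inner_add_left inner_diff_left inner_diff_right inner_commute[of x "P x"]
                power2_eq_square algebra_simps)
          then show ?thesis by simp
        qed
      qed
      moreover have "invertible_op (poly_op r P)"
        using less.hyps[OF r(2,1)] less.prems(2) quadratic by simp
      ultimately show ?thesis
        using quadratic by (simp only: poly_op_mult invertible_op_compose)
    qed
  qed
qed

lemma norm_poly_op_le:
  fixes P :: "'a::{real_inner,complete_space} \<Rightarrow>\<^sub>L 'a"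
  assumes sym: "symmetric_op P" and "0 \<le> M"
    and M: "\<And>t. \<not> invertible_op (P - t *\<^sub>R id_blinfun) \<Longrightarrow> \<bar>poly p t\<bar> \<le> M"
  shows "norm (poly_op p P) \<le> M"
proof (rule ccontr)
  assume "\<not> norm (poly_op p P) \<le> M"
  define A where "A = poly_op p P"
  have A: "norm A > M" "A \<noteq> 0" using \<open>\<not> norm (poly_op p P) \<le> M\<close> \<open>0 \<le> M\<close> by (auto simp: A_def)
  have inv: "invertible_op (A - s *\<^sub>R id_blinfun)" if s: "\<bar>s\<bar> = norm A" for s
  proof -
    have "p - [:s:] \<noteq> 0"
    proof
      \<comment> \<open>The degenerate case: \<open>p\<close> is a constant exceeding
        \<open>M\<close> in modulus, so no real \<open>t\<close> is spectral. Then
        \<open>P = 0\<close>, and invertibility at \<open>t = 0\<close> makes the whole space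
        trivial.\<close>
      assume "p - [:s:] = 0"
      then have "invertible_op (P - t *\<^sub>R id_blinfun)" for t
        using M[of t] s A(1) by fastforce
      then have P: "invertible_op (P - t *\<^sub>R id_blinfun)" for t .
      have "P = 0"
        using symmetric_op_norm_in_spectrum[OF sym] P[of "norm P"] P[of "- norm P"] by simp
      then have "id_blinfun = (0 :: 'a \<Rightarrow>\<^sub>L 'a)"
        using P[of 0] by (auto simp: invertible_op_def)
      then have "A = 0" by (metis blinfun_compose_id(1) blinfun_compose_zero(2))
      then show False using A by simp
    qed
    then have "invertible_op (poly_op (p - [:s:]) P)"
    proof (rule invertible_op_poly_op[OF sym])
      show "invertible_op (P - t *\<^sub>R id_blinfun)" if "poly (p - [:s:]) t = 0" for t
        using M[of t] that s A(1) by fastforce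
    qed
    then show ?thesis by (simp add: poly_op_diff A_def blinfun_compose_simps)
  qed
  have "A = 0"
    using symmetric_op_norm_in_spectrum[of A] symmetric_op_poly_op[OF sym] inv[of "norm A"]
      inv[of "- norm A"] by (simp add: A_def)
  then show False using A by simp
qed

section \<open>Complex-linear operators\<close>

lemma scaleC_zero: "c *\<^sub>C (0 :: 'a::complex_vector) = 0"
  by (metis add_cancel_right_left scaleC_add_right)

lemma cinner_scaleC_right: "cinner x (c *\<^sub>C y) = cnj c * cinner x y"
  by (metis cinner_commute cinner_scaleC_left complex_cnj_mult)

lemma cinner_self: "cinner x x = of_real ((norm x)\<^sup>2)"
proof -
  have "Im (cinner x x) = 0" using cinner_commute[of x x] by (metis cnj.simps(2) equal_neg_zero)
  then show ?thesis by (simp add: complex_eq_iff power2_norm_eq_inner inner_eq_Re_cinner)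
qed

lemma norm_scaleC: "norm (c *\<^sub>C x) = cmod c * norm (x :: 'a::complex_inner)"
proof -
  have "complex_of_real ((norm (c *\<^sub>C x))\<^sup>2) = c * cnj c * of_real ((norm x)\<^sup>2)"
    by (simp only: cinner_self[symmetric] cinner_scaleC_left cinner_scaleC_right mult_ac)
  also have "\<dots> = of_real ((cmod c * norm x)\<^sup>2)"
    by (simp only: complex_norm_square[symmetric] power_mult_distrib of_real_mult)
  finally have "(norm (c *\<^sub>C x))\<^sup>2 = (cmod c * norm x)\<^sup>2" by (simp only: of_real_eq_iff)
  then show ?thesis by (simp add: power2_eq_iff_nonneg)
qed

lemma bounded_linear_scaleC: "bounded_linear (\<lambda>x :: 'a::complex_inner. c *\<^sub>C x)"
  by (rule bounded_linear_intro[where K="cmod c"])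
    (simp_all add: scaleC_add_right scaleR_scaleC scaleC_scaleC norm_scaleC mult.commute)

lemma clinear_op_add: "clinear_op A \<Longrightarrow> clinear_op B \<Longrightarrow> clinear_op (A + B)"
  by (simp add: clinear_op_def blinfun.add_left scaleC_add_right)

lemma clinear_op_scaleR: "clinear_op A \<Longrightarrow> clinear_op (r *\<^sub>R A)"
  by (simp add: clinear_op_def blinfun.scaleR_left scaleR_scaleC scaleC_scaleC mult.commute)

lemma clinear_op_compose: "clinear_op A \<Longrightarrow> clinear_op B \<Longrightarrow> clinear_op (A o\<^sub>L B)"
  by (simp add: clinear_op_def)

lemma clinear_op_id: "clinear_op id_blinfun"
  by (simp add: clinear_op_def)

lemma clinear_op_poly_op: "clinear_op P \<Longrightarrow> clinear_op (poly_op p P)"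
  by (induction p rule: pCons_induct)
    (simp_all add: clinear_op_add clinear_op_scaleR clinear_op_id clinear_op_compose,
      simp add: clinear_op_def scaleC_zero)

lemma clinear_op_limit:
  assumes "X \<longlonglongrightarrow> S" "\<And>n. clinear_op (X n)"
  shows "clinear_op S"
  unfolding clinear_op_def
proof (intro allI)
  fix c x
  have "(\<lambda>n. X n (c *\<^sub>C x)) \<longlonglongrightarrow> S (c *\<^sub>C x)"
    by (intro blinfun.tendsto assms tendsto_const)
  moreover have "(\<lambda>n. c *\<^sub>C X n x) \<longlonglongrightarrow> c *\<^sub>C S x"
    by (intro bounded_linear.tendsto[OF bounded_linear_scaleC] blinfun.tendsto assms tendsto_const)
  ultimately show "S (c *\<^sub>C x) = c *\<^sub>C S x"
    using assms(2) by (simp add: clinear_op_def LIMSEQ_unique)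
qed

lemma symmetric_op_limit:
  assumes "X \<longlonglongrightarrow> S" "\<And>n. symmetric_op (X n)"
  shows "symmetric_op S"
  unfolding symmetric_op_def
proof (intro allI)
  fix x y
  have "(\<lambda>n. inner (X n x) y) \<longlonglongrightarrow> inner (S x) y" "(\<lambda>n. inner x (X n y)) \<longlonglongrightarrow> inner x (S y)"
    by (intro tendsto_inner blinfun.tendsto assms tendsto_const)+
  then show "inner (S x) y = inner x (S y)"
    using assms(2) by (simp add: symmetric_op_def LIMSEQ_unique)
qed

text \<open>The inverse of a complex-linear bijection is itself complex-linear, so the demand
  \<open>clinear_op S\<close> in \<open>spectrum\<close> excludes no inverse.\<close>

lemma spectrum_real_iff:
  assumes P: "clinear_op P"
  shows "complex_of_real t \<in> spectrum P \<longleftrightarrow> \<not> invertible_op (P - t *\<^sub>R id_blinfun)"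
proof -
  have ap: "(P - t *\<^sub>R id_blinfun) x = P x - of_real t *\<^sub>C x" for x
    by (simp add: blinfun.diff_left blinfun.scaleR_left scaleR_scaleC)
  have cl: "(P - t *\<^sub>R id_blinfun) (c *\<^sub>C x) = c *\<^sub>C (P - t *\<^sub>R id_blinfun) x" for c x
    using clinear_op_add[OF P clinear_op_scaleR[OF clinear_op_id, of "-t"]]
    by (simp add: clinear_op_def)
  have "clinear_op S" if "(P - t *\<^sub>R id_blinfun) o\<^sub>L S = id_blinfun"
    "S o\<^sub>L (P - t *\<^sub>R id_blinfun) = id_blinfun" for S
    unfolding clinear_op_def using that cl
    by (metis blinfun_apply_blinfun_compose blinfun_apply_id_blinfun)
  moreover have "A = id_blinfun \<longleftrightarrow> (\<forall>x. A x = x)" for A :: "'a \<Rightarrow>\<^sub>L 'a"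
    by (auto intro: blinfun_eqI)
  then have "(P - t *\<^sub>R id_blinfun) o\<^sub>L S = id_blinfun \<longleftrightarrow> (\<forall>x. P (S x) - of_real t *\<^sub>C S x = x)"
    and "S o\<^sub>L (P - t *\<^sub>R id_blinfun) = id_blinfun \<longleftrightarrow> (\<forall>x. S (P x - of_real t *\<^sub>C x) = x)" for S
    by (simp_all add: ap)
  ultimately show ?thesis unfolding spectrum_def invertible_op_def mem_Collect_eq by metis
qed

section \<open>Continuous functional calculus of positive operators\<close>

text \<open>Makes the space of operators complete in norm, so that Cauchy sequences of polynomials
  in \<open>P\<close> converge.\<close>

instance chilbert_space \<subseteq> banach ..

definition positive_op :: "('a::complex_inner \<Rightarrow>\<^sub>L 'a) \<Rightarrow> bool" where
  "positive_op P \<longleftrightarrow> clinear_op P \<and> symmetric_op P \<and> (\<forall>x. 0 \<le> inner (P x) x)"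

lemma positive_opD:
  assumes "positive_op P"
  shows "clinear_op P" "symmetric_op P" "0 \<le> inner (P x) x"
  using assms by (auto simp: positive_op_def)

lemma inner_blinfun_le_norm:
  fixes A :: "'a::real_inner \<Rightarrow>\<^sub>L 'a"
  shows "inner (A x) x \<le> norm A * (norm x)\<^sup>2"
proof -
  have "inner (A x) x \<le> norm (A x) * norm x" by (rule norm_cauchy_schwarz)
  also have "\<dots> \<le> norm A * norm x * norm x" by (intro mult_right_mono norm_blinfun) simp
  finally show ?thesis by (simp add: power2_eq_square mult.assoc)
qed

text \<open>For \<open>t < 0\<close> the operator \<open>P - t\<close> is coercive with constant
  \<open>- t\<close>; for \<open>t > norm P\<close> the operator \<open>t - P\<close> is coercive
  with constant \<open>t - norm P\<close>.\<close>

lemma positive_op_spectrum: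
  fixes P :: "'a::chilbert_space \<Rightarrow>\<^sub>L 'a"
  assumes P: "positive_op P" and t: "complex_of_real t \<in> spectrum P"
  shows "t \<in> {0..norm P}"
proof (rule ccontr)
  assume "t \<notin> {0..norm P}"
  then consider "t < 0" | "t > norm P" by fastforce
  then have "invertible_op (P - t *\<^sub>R id_blinfun)"
  proof cases
    case 1
    show ?thesis
    proof (rule coercive_invertible_op[of "-t"])
      show "- t * (norm x)\<^sup>2 \<le> inner ((P - t *\<^sub>R id_blinfun) x) x" for x
        using positive_opD(3)[OF P, of x]
        by (simp add: blinfun.diff_left blinfun.scaleR_left inner_diff_left power2_norm_eq_inner)
    qed (use 1 in simp)
  next
    case 2
    have "invertible_op ((-1) *\<^sub>R (P - t *\<^sub>R id_blinfun))"
    proof (rule coercive_invertible_op[of "t - norm P"])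
      show "(t - norm P) * (norm x)\<^sup>2 \<le> inner (((-1) *\<^sub>R (P - t *\<^sub>R id_blinfun)) x) x" for x
        using inner_blinfun_le_norm[of P x]
        by (simp add: blinfun.diff_left blinfun.scaleR_left blinfun.minus_left inner_diff_left
            power2_norm_eq_inner algebra_simps)
    qed (use 2 in simp)
    from invertible_op_scaleR[OF this, of "-1"] show ?thesis by simp
  qed
  then show False using t spectrum_real_iff positive_opD(1)[OF P] by blast
qed

section \<open>Existence of the limit defining \<open>cfc\<close>\<close>

text \<open>Stone-Weierstrass for the algebra of real polynomials. The endpoint \<open>M\<close> is
  left free so that one sequence can serve several operators of different norms.\<close>

lemma polynomial_approximation:
  fixes f :: "real \<Rightarrow> real"
  assumes "continuous_on {0..} f"
  obtains p where "uniform_limit {0..M} (\<lambda>n t. poly (p n) t) f sequentially"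
proof -
  have "\<exists>g. (\<exists>p. g = poly p) \<and> (\<forall>x\<in>{0..M}. \<bar>f x - g x\<bar> < 1 / Suc n)" for n
  proof (rule Stone_Weierstrass_HOL)
    show "\<exists>p. (\<lambda>x. c) = poly p" for c :: real by (rule exI[of _ "[:c:]"]) auto
    show "\<exists>p. (\<lambda>x. f x + g x) = poly p" if "(\<exists>p. f = poly p) \<and> (\<exists>p. g = poly p)"
      for f g :: "real \<Rightarrow> real"
    proof -
      from that obtain p q where "f = poly p" "g = poly q" by blast
      then have "(\<lambda>x. f x + g x) = poly (p + q)" by auto
      then show ?thesis by blast
    qed
    show "\<exists>p. (\<lambda>x. f x * g x) = poly p" if "(\<exists>p. f = poly p) \<and> (\<exists>p. g = poly p)"
      for f g :: "real \<Rightarrow> real"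
    proof -
      from that obtain p q where "f = poly p" "g = poly q" by blast
      then have "(\<lambda>x. f x * g x) = poly (p * q)" by auto
      then show ?thesis by blast
    qed
    show "\<exists>f. (\<exists>p. f = poly p) \<and> f x \<noteq> f y" if "x \<in> {0..M} \<and> y \<in> {0..M} \<and> x \<noteq> y" for x y
      using that by (intro exI[of _ "poly [:0, 1:]"]) auto
    show "continuous_on {0..M} f" using assms by (rule continuous_on_subset) auto
  qed (auto intro: continuous_intros)
  then obtain p where p: "\<And>n x. x \<in> {0..M} \<Longrightarrow> \<bar>f x - poly (p n) x\<bar> < 1 / Suc n" by metis
  have "uniform_limit {0..M} (\<lambda>n t. poly (p n) t) f sequentially"
    unfolding uniform_limit_sequentially_iff
  proof (intro allI impI)
    fix e :: real assume "e > 0"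
    then obtain N where N: "1 / Suc N < e" using nat_approx_posE by blast
    have "dist (poly (p n) x) (f x) < e" if "n \<ge> N" "x \<in> {0..M}" for n x
    proof -
      have "1 / real (Suc n) \<le> 1 / real (Suc N)" using that by (simp add: frac_le)
      then show ?thesis using p[OF that(2), of n] N by (simp add: dist_real_def abs_minus_commute)
    qed
    then show "\<exists>N. \<forall>n\<ge>N. \<forall>x\<in>{0..M}. dist (poly (p n) x) (f x) < e" by blast
  qed
  then show thesis by (rule that)
qed

lemma norm_poly_op_spectrum_le:
  fixes P :: "'a::chilbert_space \<Rightarrow>\<^sub>L 'a"
  assumes "positive_op P" "0 \<le> M"
    and "\<And>t. complex_of_real t \<in> spectrum P \<Longrightarrow> \<bar>poly p t\<bar> \<le> M"
  shows "norm (poly_op p P) \<le> M"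
  using assms by (intro norm_poly_op_le positive_opD(2)) (auto simp: spectrum_real_iff positive_opD(1))

text \<open>Taking \<open>q = p\<close> yields the Cauchy property; distinct sequences show that the
  limit depends only on \<open>f\<close>.\<close>

lemma poly_op_diff_small:
  fixes P :: "'a::chilbert_space \<Rightarrow>\<^sub>L 'a"
  assumes P: "positive_op P" and K: "K = {t. complex_of_real t \<in> spectrum P}"
    and p: "uniform_limit K (\<lambda>n t. poly (p n) t) f sequentially"
    and q: "uniform_limit K (\<lambda>n t. poly (q n) t) f sequentially"
    and e: "e > 0"
  shows "\<exists>N. \<forall>m\<ge>N. \<forall>n\<ge>N. norm (poly_op (p m) P - poly_op (q n) P) < e"
proof -
  have "e / 3 > 0" using e by simp
  obtain N1 where N1: "\<And>n t. n \<ge> N1 \<Longrightarrow> t \<in> K \<Longrightarrow> dist (poly (p n) t) (f t) < e / 3"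
    using p \<open>e / 3 > 0\<close> unfolding uniform_limit_sequentially_iff by blast
  obtain N2 where N2: "\<And>n t. n \<ge> N2 \<Longrightarrow> t \<in> K \<Longrightarrow> dist (poly (q n) t) (f t) < e / 3"
    using q \<open>e / 3 > 0\<close> unfolding uniform_limit_sequentially_iff by blast
  have "norm (poly_op (p m) P - poly_op (q n) P) < e" if "m \<ge> max N1 N2" "n \<ge> max N1 N2" for m n
  proof -
    have "norm (poly_op (p m - q n) P) \<le> 2 * (e / 3)"
    proof (rule norm_poly_op_spectrum_le[OF P])
      show "\<bar>poly (p m - q n) t\<bar> \<le> 2 * (e / 3)" if "complex_of_real t \<in> spectrum P" for t
      proof -
        have "\<bar>poly (p m) t - f t\<bar> < e / 3" "\<bar>poly (q n) t - f t\<bar> < e / 3"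
          using N1[of m t] N2[of n t] that \<open>m \<ge> max N1 N2\<close> \<open>n \<ge> max N1 N2\<close>
          by (simp_all add: K dist_real_def)
        then show ?thesis unfolding poly_diff by linarith
      qed
    qed (use e in simp)
    then show ?thesis using e by (simp add: poly_op_diff)
  qed
  then show ?thesis by blast
qed

text \<open>This resolves the description operator in \<open>cfc\<close>: the limit of one
  approximating sequence is the limit of all of them. Uniqueness needs \<open>p\<close> as a
  witness, since the defining condition would be vacuous without an approximating sequence.\<close>

lemma cfc_tendsto:
  fixes P :: "'a::chilbert_space \<Rightarrow>\<^sub>L 'a"
  assumes P: "positive_op P" and f: "continuous_on {0..} f" and M: "norm P \<le> M"
    and lim: "uniform_limit {0..M} (\<lambda>n t. poly (p n) t) f sequentially"
  shows "(\<lambda>n. poly_op (p n) P) \<longlonglongrightarrow> cfc f P"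
proof -
  define K where "K = {t. complex_of_real t \<in> spectrum P}"
  have "K \<subseteq> {0..M}" using positive_op_spectrum[OF P] M unfolding K_def by fastforce
  then have p: "uniform_limit K (\<lambda>n t. poly (p n) t) f sequentially"
    using lim uniform_limit_on_subset by blast
  have "Cauchy (\<lambda>n. poly_op (p n) P)"
    using poly_op_diff_small[OF P K_def p p] unfolding Cauchy_def dist_norm by blast
  then obtain L where L: "(\<lambda>n. poly_op (p n) P) \<longlonglongrightarrow> L"
    using Cauchy_convergent convergent_def by blast
  have *: "(\<lambda>n. poly_op (q n) P) \<longlonglongrightarrow> L"
    if q: "uniform_limit K (\<lambda>n t. poly (q n) t) f sequentially" for q
  proof -
    have "(\<lambda>n. poly_op (q n) P - poly_op (p n) P) \<longlonglongrightarrow> 0"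
      unfolding LIMSEQ_def dist_norm
      using poly_op_diff_small[OF P K_def q p] by (metis diff_zero)
    from tendsto_add[OF this L] show ?thesis by simp
  qed
  have "cfc f P = L"
    unfolding cfc_def K_def[symmetric] using * p L LIMSEQ_unique by (intro the_equality) blast+
  with L show ?thesis by simp
qed

section \<open>Algebra, order, norm and composition in the calculus\<close>

context
  fixes P :: "'a::chilbert_space \<Rightarrow>\<^sub>L 'a"
  assumes P: "positive_op P"
begin

lemma cfc_approx:
  assumes "continuous_on {0..} f"
  obtains p where "uniform_limit {0..norm P} (\<lambda>n t. poly (p n) t) f sequentially"
    "(\<lambda>n. poly_op (p n) P) \<longlonglongrightarrow> cfc f P"
  using polynomial_approximation[OF assms] cfc_tendsto[OF P assms order_refl] by metis

lemma cfc_eqI: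
  assumes "continuous_on {0..} f"
    and "uniform_limit {0..norm P} (\<lambda>n t. poly (p n) t) f sequentially"
    and "(\<lambda>n. poly_op (p n) P) \<longlonglongrightarrow> S"
  shows "cfc f P = S"
  using cfc_tendsto[OF P assms(1) order_refl assms(2)] assms(3) by (rule LIMSEQ_unique)

lemma cfc_poly: "cfc (poly p) P = poly_op p P"
  by (rule cfc_eqI[where p="\<lambda>_. p"]) (auto intro!: continuous_intros uniform_limit_const)

lemma cfc_const: "cfc (\<lambda>_. c) P = c *\<^sub>R id_blinfun"
proof -
  have "poly [:c:] = (\<lambda>_. c)" by auto
  then show ?thesis using cfc_poly[of "[:c:]"] by simp
qed

lemma cfc_ident: "cfc (\<lambda>t. t) P = P"
proof -
  have "poly [:0, 1:] = (\<lambda>t::real. t)" by auto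
  then show ?thesis using cfc_poly[of "[:0, 1:]"] by simp
qed

lemma cfc_add:
  assumes f: "continuous_on {0..} f" and g: "continuous_on {0..} g"
  shows "cfc (\<lambda>t. f t + g t) P = cfc f P + cfc g P"
proof -
  obtain p where p: "uniform_limit {0..norm P} (\<lambda>n t. poly (p n) t) f sequentially"
    "(\<lambda>n. poly_op (p n) P) \<longlonglongrightarrow> cfc f P" using cfc_approx[OF f] .
  obtain q where q: "uniform_limit {0..norm P} (\<lambda>n t. poly (q n) t) g sequentially"
    "(\<lambda>n. poly_op (q n) P) \<longlonglongrightarrow> cfc g P" using cfc_approx[OF g] .
  show ?thesis
  proof (rule cfc_eqI[where p="\<lambda>n. p n + q n"])
    show "uniform_limit {0..norm P} (\<lambda>n t. poly (p n + q n) t) (\<lambda>t. f t + g t) sequentially"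
      using uniform_limit_add[OF p(1) q(1)] by simp
    show "(\<lambda>n. poly_op (p n + q n) P) \<longlonglongrightarrow> cfc f P + cfc g P"
      using tendsto_add[OF p(2) q(2)] by (simp add: poly_op_add)
  qed (intro continuous_intros f g)
qed

lemma cfc_mult:
  assumes f: "continuous_on {0..} f" and g: "continuous_on {0..} g"
  shows "cfc (\<lambda>t. f t * g t) P = cfc f P o\<^sub>L cfc g P"
proof -
  obtain p where p: "uniform_limit {0..norm P} (\<lambda>n t. poly (p n) t) f sequentially"
    "(\<lambda>n. poly_op (p n) P) \<longlonglongrightarrow> cfc f P" using cfc_approx[OF f] .
  obtain q where q: "uniform_limit {0..norm P} (\<lambda>n t. poly (q n) t) g sequentially"
    "(\<lambda>n. poly_op (q n) P) \<longlonglongrightarrow> cfc g P" using cfc_approx[OF g] .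
  have bdd: "bounded (h ` {0..norm P})" if "continuous_on {0..} h" for h :: "real \<Rightarrow> real"
    using that by (intro compact_imp_bounded compact_continuous_image)
      (auto intro: continuous_on_subset)
  show ?thesis
  proof (rule cfc_eqI[where p="\<lambda>n. p n * q n"])
    show "uniform_limit {0..norm P} (\<lambda>n t. poly (p n * q n) t) (\<lambda>t. f t * g t) sequentially"
      using uniform_lim_mult[OF p(1) q(1) bdd[OF f] bdd[OF g]] by simp
    show "(\<lambda>n. poly_op (p n * q n) P) \<longlonglongrightarrow> (cfc f P o\<^sub>L cfc g P)"
      using bounded_bilinear.tendsto[OF bounded_bilinear_blinfun_compose p(2) q(2)]
      by (simp add: poly_op_mult)
  qed (intro continuous_intros f g)
qed

lemma cfc_scaleR:
  assumes "continuous_on {0..} f"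
  shows "cfc (\<lambda>t. c * f t) P = c *\<^sub>R cfc f P"
  using cfc_mult[of "\<lambda>_. c" f] assms by (simp add: cfc_const blinfun_compose_simps)

lemma cfc_diff:
  assumes "continuous_on {0..} f" "continuous_on {0..} g"
  shows "cfc (\<lambda>t. f t - g t) P = cfc f P - cfc g P"
  using cfc_add[of f "\<lambda>t. (-1) * g t"] cfc_scaleR[of g "-1"] assms
  by (simp add: continuous_on_minus)

lemma cfc_cong:
  assumes f: "continuous_on {0..} f" and g: "continuous_on {0..} g"
    and eq: "\<And>t. 0 \<le> t \<Longrightarrow> f t = g t"
  shows "cfc f P = cfc g P"
proof -
  obtain p where p: "uniform_limit {0..norm P} (\<lambda>n t. poly (p n) t) g sequentially"
    "(\<lambda>n. poly_op (p n) P) \<longlonglongrightarrow> cfc g P" using cfc_approx[OF g] .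
  have "uniform_limit {0..norm P} (\<lambda>n t. poly (p n) t) f sequentially"
    using p(1) by (rule uniform_limit_cong'[THEN iffD1, rotated -1]) (auto simp: eq)
  then show ?thesis using p(2) f by (intro cfc_eqI)
qed

lemma cfc_clinear_symmetric:
  assumes f: "continuous_on {0..} f"
  shows "clinear_op (cfc f P)" "symmetric_op (cfc f P)"
proof -
  obtain p where p: "(\<lambda>n. poly_op (p n) P) \<longlonglongrightarrow> cfc f P" using cfc_approx[OF f] .
  show "clinear_op (cfc f P)" "symmetric_op (cfc f P)"
    using p positive_opD(1,2)[OF P]
    by (auto intro: clinear_op_limit symmetric_op_limit clinear_op_poly_op symmetric_op_poly_op)
qed

text \<open>With \<open>h\<close> the square root of \<open>f\<close>, the quadratic form of
  \<open>cfc f P\<close> at \<open>x\<close> is the squared norm of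
  \<open>cfc h P x\<close>.\<close>

lemma positive_op_cfc:
  assumes f: "continuous_on {0..} f" and pos: "\<And>t. 0 \<le> t \<Longrightarrow> 0 \<le> f t"
  shows "positive_op (cfc f P)"
proof -
  define h where "h t = sqrt (f t)" for t
  have h: "continuous_on {0..} h" unfolding h_def by (intro continuous_intros f)
  have "cfc f P = cfc (\<lambda>t. h t * h t) P"
    by (intro cfc_cong f continuous_intros h) (simp add: h_def pos)
  then have "cfc f P = cfc h P o\<^sub>L cfc h P" using cfc_mult[OF h h] by simp
  then have "inner (cfc f P x) x = inner (cfc h P x) (cfc h P x)" for x
    using cfc_clinear_symmetric(2)[OF h] by (metis blinfun_apply_blinfun_compose symmetric_op_def)
  then show ?thesis using cfc_clinear_symmetric[OF f] by (simp add: positive_op_def)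
qed

lemma cfc_mono:
  assumes "continuous_on {0..} f" "continuous_on {0..} g" "\<And>t. 0 \<le> t \<Longrightarrow> f t \<le> g t"
  shows "inner (cfc f P x) x \<le> inner (cfc g P x) x"
proof -
  have "positive_op (cfc (\<lambda>t. g t - f t) P)"
    by (intro positive_op_cfc continuous_intros assms) (simp add: assms)
  from positive_opD(3)[OF this, of x] show ?thesis
    by (simp add: cfc_diff assms blinfun.diff_left inner_diff_left)
qed

lemma norm_cfc_le:
  assumes f: "continuous_on {0..} f" and B: "\<And>t. t \<in> {0..norm P} \<Longrightarrow> \<bar>f t\<bar> \<le> B" and "0 \<le> B"
  shows "norm (cfc f P) \<le> B"
proof (rule field_le_epsilon)
  fix e :: real assume e: "e > 0"
  obtain p where p: "uniform_limit {0..norm P} (\<lambda>n t. poly (p n) t) f sequentially"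
    "(\<lambda>n. poly_op (p n) P) \<longlonglongrightarrow> cfc f P" using cfc_approx[OF f] .
  obtain N where N: "\<And>n t. n \<ge> N \<Longrightarrow> t \<in> {0..norm P} \<Longrightarrow> dist (poly (p n) t) (f t) < e"
    using p(1) e unfolding uniform_limit_sequentially_iff by blast
  have "norm (poly_op (p n) P) \<le> B + e" if "n \<ge> N" for n
  proof (rule norm_poly_op_spectrum_le[OF P])
    show "\<bar>poly (p n) t\<bar> \<le> B + e" if "complex_of_real t \<in> spectrum P" for t
      using N[OF \<open>n \<ge> N\<close> positive_op_spectrum[OF P that]] B[OF positive_op_spectrum[OF P that]]
      by (simp add: dist_real_def)
  qed (use e \<open>0 \<le> B\<close> in simp)
  then show "norm (cfc f P) \<le> B + e"
    using tendsto_norm[OF p(2)] by (intro LIMSEQ_le_const2) auto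
qed

lemma poly_op_cfc:
  assumes u: "continuous_on {0..} u"
  shows "poly_op p (cfc u P) = cfc (\<lambda>t. poly p (u t)) P"
proof (induction p rule: pCons_induct)
  case (pCons a p)
  have c: "continuous_on {0..} (\<lambda>t. poly q (u t))" for q by (intro continuous_intros u)
  show ?case
    using pCons cfc_add[of "\<lambda>_. a" "\<lambda>t. u t * poly p (u t)"] cfc_mult[OF u c] u c
    by (simp add: cfc_const continuous_on_mult)
qed (use cfc_const[of 0] in simp)

text \<open>For polynomials \<open>h\<close> this is \<open>poly_op_cfc\<close>. In general
  \<open>h\<close> is approximated on \<open>{0..B}\<close>, where \<open>B\<close> bounds both
  \<open>u\<close> on \<open>{0..norm P}\<close> and the norm of \<open>cfc u P\<close>; both sides
  are then limits of the same sequence.\<close>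

lemma cfc_cfc:
  assumes u: "continuous_on {0..} u" "\<And>t. 0 \<le> t \<Longrightarrow> 0 \<le> u t" and h: "continuous_on {0..} h"
  shows "cfc h (cfc u P) = cfc (\<lambda>t. h (u t)) P"
proof -
  have hu: "continuous_on {0..} (\<lambda>t. h (u t))"
    by (rule continuous_on_compose2[OF h u(1)]) (auto simp: u)
  have "compact (u ` {0..norm P})"
    using u by (intro compact_continuous_image) (auto intro: continuous_on_subset)
  then obtain B where B: "B > 0" "\<And>t. t \<in> {0..norm P} \<Longrightarrow> \<bar>u t\<bar> \<le> B"
    using compact_imp_bounded bounded_pos by (metis imageI real_norm_def)
  obtain p where p: "uniform_limit {0..B} (\<lambda>n t. poly (p n) t) h sequentially"
    using polynomial_approximation[OF h] .
  have "(\<lambda>n. cfc (\<lambda>t. poly (p n) (u t)) P) \<longlonglongrightarrow> cfc h (cfc u P)"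
    using cfc_tendsto[OF positive_op_cfc[OF u] h _ p] norm_cfc_le[OF u(1) B(2)] B(1)
    by (simp add: poly_op_cfc u)
  moreover have "(\<lambda>n. cfc (\<lambda>t. poly (p n) (u t)) P) \<longlonglongrightarrow> cfc (\<lambda>t. h (u t)) P"
    unfolding LIMSEQ_def
  proof (intro allI impI)
    fix e :: real assume e: "e > 0"
    then have "e / 2 > 0" by simp
    then obtain N where N: "\<And>n t. n \<ge> N \<Longrightarrow> t \<in> {0..B} \<Longrightarrow> dist (poly (p n) t) (h t) < e / 2"
      using p unfolding uniform_limit_sequentially_iff by blast
    have "dist (cfc (\<lambda>t. poly (p n) (u t)) P) (cfc (\<lambda>t. h (u t)) P) < e" if "n \<ge> N" for n
    proof -
      have c: "continuous_on {0..} (\<lambda>t. poly (p n) (u t))" by (intro continuous_intros u)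
      have "norm (cfc (\<lambda>t. poly (p n) (u t) - h (u t)) P) \<le> e / 2"
      proof (rule norm_cfc_le)
        show "\<bar>poly (p n) (u t) - h (u t)\<bar> \<le> e / 2" if "t \<in> {0..norm P}" for t
          using N[OF \<open>n \<ge> N\<close>, of "u t"] B(2)[OF that] u(2)[of t] that by (simp add: dist_real_def)
      qed (use e in \<open>auto intro!: continuous_intros c hu\<close>)
      then show ?thesis using e by (simp add: cfc_diff c hu dist_norm)
    qed
    then show "\<exists>N. \<forall>n\<ge>N. dist (cfc (\<lambda>t. poly (p n) (u t)) P) (cfc (\<lambda>t. h (u t)) P) < e" by blast
  qed
  ultimately show ?thesis by (rule LIMSEQ_unique)
qed

end

text \<open>A single polynomial sequence, approximating \<open>f\<close> on an interval that
  contains both spectra, carries the relation from polynomials to the limit.\<close>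

lemma cfc_intertwine:
  fixes A B :: "'a::chilbert_space \<Rightarrow>\<^sub>L 'a"
  assumes A: "positive_op A" and B: "positive_op B" and f: "continuous_on {0..} f"
    and T: "T o\<^sub>L A = B o\<^sub>L T"
  shows "T o\<^sub>L cfc f A = cfc f B o\<^sub>L T"
proof -
  obtain p where p: "uniform_limit {0..max (norm A) (norm B)} (\<lambda>n t. poly (p n) t) f sequentially"
    using polynomial_approximation[OF f] .
  have "(\<lambda>n. T o\<^sub>L poly_op (p n) A) \<longlonglongrightarrow> (T o\<^sub>L cfc f A)"
    by (intro bounded_bilinear.tendsto[OF bounded_bilinear_blinfun_compose] tendsto_const
        cfc_tendsto[OF A f _ p]) simp
  moreover have "(\<lambda>n. poly_op (p n) B o\<^sub>L T) \<longlonglongrightarrow> (cfc f B o\<^sub>L T)"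
    by (intro bounded_bilinear.tendsto[OF bounded_bilinear_blinfun_compose] tendsto_const
        cfc_tendsto[OF B f _ p]) simp
  ultimately show ?thesis
    using T by (simp add: poly_op_intertwine LIMSEQ_unique)
qed

section \<open>Adjoints\<close>

lemma Im_cinner: "Im (cinner x y) = - inner (\<i> *\<^sub>C x) y"
  by (simp add: inner_eq_Re_cinner cinner_scaleC_left)

text \<open>The imaginary part of \<open>cinner\<close> is, up to sign, the real inner product with
  \<open>x\<close> replaced by \<open>\<i> *\<^sub>C x\<close>, so complex linearity of
  \<open>T\<close> upgrades a real adjoint to a complex one.\<close>

lemma inner_adjoint_imp_cinner:
  fixes T S :: "'a::complex_inner \<Rightarrow>\<^sub>L 'a"
  assumes T: "clinear_op T" and S: "\<And>x y. inner (T x) y = inner x (S y)"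
  shows "cinner (T x) y = cinner x (S y)"
proof (rule complex_eqI)
  show "Re (cinner (T x) y) = Re (cinner x (S y))"
    using S[of x y] by (simp add: inner_eq_Re_cinner)
  show "Im (cinner (T x) y) = Im (cinner x (S y))"
    using S[of "\<i> *\<^sub>C x" y] T by (simp add: Im_cinner clinear_op_def)
qed

lemma adj_eqI:
  fixes T S :: "'a::chilbert_space \<Rightarrow>\<^sub>L 'a"
  assumes "clinear_op T" "\<And>x y. inner (T x) y = inner x (S y)"
  shows "adj T = S"
  unfolding adj_def
proof (rule the_equality)
  show "\<forall>x y. cinner (T x) y = cinner x (S y)"
    using inner_adjoint_imp_cinner[OF assms] by blast
  fix R :: "'a \<Rightarrow>\<^sub>L 'a" assume R: "\<forall>x y. cinner (T x) y = cinner x (R y)"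
  show "R = S"
  proof (rule blinfun_eqI, rule inner_eqI)
    show "inner x (R y) = inner x (S y)" for x y
      using R assms(2)[of x y] by (simp add: inner_eq_Re_cinner)
  qed
qed

lemma inner_adj:
  fixes T :: "'a::chilbert_space \<Rightarrow>\<^sub>L 'a"
  assumes "clinear_op T"
  shows "inner (T x) y = inner x (adj T y)"
proof -
  obtain S :: "'a \<Rightarrow>\<^sub>L 'a" where S: "\<And>x y. inner (T x) y = inner x (S y)"
    using real_adjoint_exists[of T] by blast
  then show ?thesis using adj_eqI[OF assms S] by simp
qed

lemma clinear_op_adj:
  fixes T :: "'a::chilbert_space \<Rightarrow>\<^sub>L 'a"
  assumes T: "clinear_op T"
  shows "clinear_op (adj T)"
  unfolding clinear_op_def
proof (intro allI)
  fix c x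
  note adj = inner_adjoint_imp_cinner[OF T inner_adj[OF T]]
  have "cinner y (adj T (c *\<^sub>C x)) = cinner y (c *\<^sub>C adj T x)" for y
    unfolding adj[symmetric] cinner_scaleC_right ..
  then have "inner y (adj T (c *\<^sub>C x)) = inner y (c *\<^sub>C adj T x)" for y
    by (simp only: inner_eq_Re_cinner)
  then show "adj T (c *\<^sub>C x) = c *\<^sub>C adj T x"
    by (rule inner_eqI)
qed

lemma adj_adj:
  fixes T :: "'a::chilbert_space \<Rightarrow>\<^sub>L 'a"
  assumes T: "clinear_op T"
  shows "adj (adj T) = T"
proof (rule adj_eqI[OF clinear_op_adj[OF T]])
  show "inner (adj T x) y = inner x (T y)" for x y
    using inner_adj[OF T, of y x] by (simp add: inner_commute)
qed

lemma positive_op_adj_compose: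
  fixes T :: "'a::chilbert_space \<Rightarrow>\<^sub>L 'a"
  assumes T: "clinear_op T"
  shows "positive_op (adj T o\<^sub>L T)"
proof -
  have "inner (adj T (T x)) y = inner (T x) (T y)" for x y
    using inner_adj[OF T, of y "T x"] by (simp add: inner_commute)
  then show ?thesis
    by (simp add: positive_op_def symmetric_op_def clinear_op_compose clinear_op_adj T
        flip: inner_adj[OF T])
qed

section \<open>Operator inequalities\<close>

text \<open>
  With \<open>v = sqrt (F + \<epsilon>)\<close> and \<open>u = 1 / v\<close>, write
  \<open>\<langle>T x, y\<rangle> = \<langle>v(A) x, u(A) T\<^sup>* y\<rangle>\<close>; intertwining turns \<open>\<parallel>u(A) T\<^sup>* y\<parallel>\<^sup>2\<close> into
  \<open>\<langle>(t / (F + \<epsilon>))(B) y, y\<rangle>\<close>. The shift by \<open>\<epsilon>\<close> replaces a polar decomposition of \<open>T\<close>.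
\<close>

lemma mixed_Schwarz:
  fixes T :: "'a::chilbert_space \<Rightarrow>\<^sub>L 'a"
  assumes T: "clinear_op T"
    and F: "continuous_on {0..} F" "\<And>t. 0 \<le> t \<Longrightarrow> 0 \<le> F t"
    and G: "continuous_on {0..} G" "\<And>t. 0 \<le> t \<Longrightarrow> 0 \<le> G t"
    and FG: "\<And>t. 0 \<le> t \<Longrightarrow> F t * G t = t"
  shows "(inner (T x) y)\<^sup>2
    \<le> inner (cfc F (adj T o\<^sub>L T) x) x * inner (cfc G (T o\<^sub>L adj T) y) y"
proof -
  define S A B where "S = adj T" and "A = S o\<^sub>L T" and "B = T o\<^sub>L S"
  have S: "clinear_op S" and adj_S: "adj S = T"
    using T by (auto simp: S_def clinear_op_adj adj_adj)
  have A: "positive_op A" and B: "positive_op B"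
    using positive_op_adj_compose[OF T] positive_op_adj_compose[OF S]
    by (auto simp: S_def A_def B_def adj_adj T)
  have G0: "0 \<le> inner (cfc G B y) y"
    using positive_opD(3)[OF positive_op_cfc[OF B G]] .
  have "(inner (T x) y)\<^sup>2 \<le> (inner (cfc F A x) x + \<epsilon> * (norm x)\<^sup>2) * inner (cfc G B y) y"
    if e: "\<epsilon> > 0" for \<epsilon>
  proof -
    define v where "v t = sqrt (F t + \<epsilon>)" for t
    define u where "u t = 1 / v t" for t
    have Fe: "F t + \<epsilon> > 0" if "0 \<le> t" for t using F(2)[OF that] e by simp
    have v: "continuous_on {0..} v" unfolding v_def by (intro continuous_intros F)
    have v_pos: "v t > 0" if "0 \<le> t" for t using Fe[OF that] by (simp add: v_def)
    have u: "continuous_on {0..} u"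
      unfolding u_def using v_pos by (intro continuous_intros v) fastforce
    have uu: "continuous_on {0..} (\<lambda>t. u t * u t)" by (intro continuous_intros u)
    have "cfc v A o\<^sub>L cfc u A = cfc (\<lambda>_. 1) A"
    proof (subst cfc_mult[OF A v u, symmetric], intro cfc_cong[OF A] continuous_intros v u)
      show "v t * u t = 1" if "0 \<le> t" for t using v_pos[OF that] by (simp add: u_def)
    qed
    then have vu: "cfc v A (cfc u A z) = z" for z
      by (metis A blinfun_apply_blinfun_compose blinfun_apply_id_blinfun cfc_const scaleR_one)
    have sym: "inner (cfc h A a) b = inner a (cfc h A b)" if "continuous_on {0..} h" for h a b
      using cfc_clinear_symmetric(2)[OF A that] by (simp add: symmetric_op_def)
    have "inner (T x) y = inner x (S y)" unfolding S_def by (rule inner_adj[OF T])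
    also have "\<dots> = inner (cfc v A x) (cfc u A (S y))" by (simp add: sym[OF v] vu)
    finally have "(inner (T x) y)\<^sup>2 \<le> (norm (cfc v A x))\<^sup>2 * (norm (cfc u A (S y)))\<^sup>2"
      using Cauchy_Schwarz_ineq[of "cfc v A x" "cfc u A (S y)"] by (simp add: power2_norm_eq_inner)
    moreover have "(norm (cfc v A x))\<^sup>2 = inner (cfc F A x) x + \<epsilon> * (norm x)\<^sup>2"
    proof -
      have "cfc (\<lambda>t. v t * v t) A = cfc (\<lambda>t. F t + \<epsilon>) A"
        using Fe by (intro cfc_cong[OF A] continuous_intros v F) (simp add: v_def less_imp_le)
      then have "cfc v A o\<^sub>L cfc v A = cfc F A + \<epsilon> *\<^sub>R id_blinfun"
        using cfc_mult[OF A v v] cfc_add[OF A F(1), of "\<lambda>_. \<epsilon>"] by (simp add: cfc_const[OF A])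
      then have "cfc v A (cfc v A x) = cfc F A x + \<epsilon> *\<^sub>R x"
        by (metis blinfun.add_left blinfun.scaleR_left blinfun_apply_blinfun_compose
            blinfun_apply_id_blinfun)
      then have "inner x (cfc v A (cfc v A x)) = inner (cfc F A x) x + \<epsilon> * inner x x"
        by (simp add: inner_add_right inner_commute)
      then show ?thesis by (simp add: power2_norm_eq_inner sym[OF v])
    qed
    moreover have "(norm (cfc u A (S y)))\<^sup>2 \<le> inner (cfc G B y) y"
    proof -
      have "(norm (cfc u A (S y)))\<^sup>2 = inner (cfc u A (cfc u A (S y))) (S y)"
        by (simp add: power2_norm_eq_inner sym[OF u])
      also have "\<dots> = inner (T (cfc (\<lambda>t. u t * u t) A (S y))) y"
        using inner_adj[OF T] cfc_mult[OF A u u] by (simp add: S_def)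
      also have "\<dots> = inner (cfc (\<lambda>t. u t * u t) B (T (S y))) y"
      proof -
        have "T o\<^sub>L A = B o\<^sub>L T" by (simp add: A_def B_def blinfun_compose_assoc)
        from arg_cong[OF cfc_intertwine[OF A B uu this], of "\<lambda>X. X (S y)"] show ?thesis
          by (simp only: blinfun_apply_blinfun_compose)
      qed
      also have "\<dots> = inner (cfc (\<lambda>t. u t * u t * t) B y) y"
      proof -
        have "cfc (\<lambda>t. u t * u t * t) B = cfc (\<lambda>t. u t * u t) B o\<^sub>L B"
          using cfc_mult[OF B uu continuous_on_id] by (simp only: cfc_ident[OF B])
        moreover have "B y = T (S y)" by (simp add: B_def)
        ultimately show ?thesis by (simp only: blinfun_apply_blinfun_compose)
      qed
      also have "\<dots> \<le> inner (cfc G B y) y"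
      proof (rule cfc_mono[OF B])
        show "u t * u t * t \<le> G t" if "0 \<le> t" for t
        proof -
          \<comment> \<open>Here \<open>t = F t * G t\<close>, and the shift only adds the
            non-negative term \<open>\<epsilon> * G t\<close>.\<close>
          have "t \<le> G t * (F t + \<epsilon>)"
            using FG[OF that] G(2)[OF that] e by (simp add: algebra_simps)
          then show ?thesis using Fe[OF that] by (simp add: u_def v_def pos_divide_le_eq)
        qed
      qed (intro continuous_intros u G)+
      finally show ?thesis .
    qed
    ultimately show ?thesis
      by (smt (verit) mult_left_mono zero_le_power2)
  qed
  note bound = this
  \<comment> \<open>The operators \<open>cfc F A\<close> and \<open>cfc G B\<close> are independent
    of \<open>\<epsilon>\<close>, so the shift disappears as \<open>\<epsilon>\<close> tends to 0
    from the right.\<close>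
  have "((\<lambda>\<epsilon>. (inner (cfc F A x) x + \<epsilon> * (norm x)\<^sup>2) * inner (cfc G B y) y)
      \<longlongrightarrow> (inner (cfc F A x) x + 0 * (norm x)\<^sup>2) * inner (cfc G B y) y) (at_right 0)"
    by (intro tendsto_intros)
  then have "(inner (T x) y)\<^sup>2 \<le> (inner (cfc F A x) x + 0 * (norm x)\<^sup>2) * inner (cfc G B y) y"
  proof (rule tendsto_lowerbound)
    show "\<forall>\<^sub>F \<epsilon> in at_right 0.
        (inner (T x) y)\<^sup>2 \<le> (inner (cfc F A x) x + \<epsilon> * (norm x)\<^sup>2) * inner (cfc G B y) y"
      using eventually_at_right_less[of "0::real"] by (rule eventually_mono) (rule bound)
  qed simp
  then show ?thesis by (simp add: A_def B_def S_def)
qed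

text \<open>Integrate Young's inequality \<open>a\<^bsup>p-1\<^esup> F \<le> F\<^bsup>p\<^esup> / p + a\<^sup>p / q\<close> against the spectral measure of \<open>x\<close>.\<close>

lemma McCarthy_inequality:
  fixes P :: "'a::chilbert_space \<Rightarrow>\<^sub>L 'a"
  assumes P: "positive_op P" and F: "continuous_on {0..} F" "\<And>t. 0 \<le> t \<Longrightarrow> 0 \<le> F t"
    and p: "p > 1" and x: "norm x = 1"
  shows "inner (cfc F P x) x powr p \<le> inner (cfc (\<lambda>t. F t powr p) P x) x"
proof -
  define a where "a = inner (cfc F P x) x"
  \<comment> \<open>The conjugate exponent; \<open>(p - 1) * q = p\<close> turns the second Young
    term \<open>(a powr (p - 1)) powr q\<close> into \<open>a powr p\<close>.\<close>
  define q where "q = p / (p - 1)"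
  have q: "q > 1" "1 / p + 1 / q = 1" "(p - 1) * q = p" using p by (auto simp: q_def field_simps)
  have a: "a \<ge> 0" unfolding a_def using positive_opD(3)[OF positive_op_cfc[OF P F]] .
  have Fp: "continuous_on {0..} (\<lambda>t. F t powr p)"
    using p F by (intro continuous_on_powr' continuous_intros) auto
  have "inner (cfc (\<lambda>t. a powr (p - 1) * F t) P x) x
      \<le> inner (cfc (\<lambda>t. (1 / p) * F t powr p + a powr p / q) P x) x"
  proof (rule cfc_mono[OF P])
    show "a powr (p - 1) * F t \<le> (1 / p) * F t powr p + a powr p / q" if "0 \<le> t" for t
    proof -
      have "(a powr (p - 1)) powr q = a powr p" by (simp add: powr_powr q(3))
      then show ?thesis
        using Youngs_inequality[OF p q(1,2) F(2)[OF that], of "a powr (p - 1)"]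
        by (simp add: mult.commute)
    qed
  qed (intro continuous_intros F Fp)+
  moreover have "cfc (\<lambda>t. (1 / p) * F t powr p + a powr p / q) P
      = (1 / p) *\<^sub>R cfc (\<lambda>t. F t powr p) P + (a powr p / q) *\<^sub>R id_blinfun"
    unfolding cfc_add[OF P continuous_on_mult_left[OF Fp] continuous_on_const]
      cfc_scaleR[OF P Fp] cfc_const[OF P] ..
  moreover have "inner x x = 1" using x by (simp flip: power2_norm_eq_inner)
  ultimately have "a powr (p - 1) * a \<le> inner (cfc (\<lambda>t. F t powr p) P x) x / p + a powr p / q"
    by (simp add: cfc_scaleR[OF P F(1)] blinfun.add_left blinfun.scaleR_left inner_add_left a_def)
  \<comment> \<open>At \<open>a = 0\<close> both sides vanish because
    \<open>0 powr p = 0\<close>.\<close>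
  moreover have "a powr (p - 1) * a = a powr p"
    using a p by (cases "a = 0") (auto simp: powr_diff)
  \<comment> \<open>Splitting \<open>a powr p\<close> by conjugacy cancels the part divided by
    \<open>q\<close> and leaves the claim divided by \<open>p\<close>.\<close>
  moreover have "a powr p = a powr p / p + a powr p / q"
    using q(2) by (metis add_divide_distrib distrib_left mult.right_neutral times_divide_eq_right)
  ultimately have "a powr p / p \<le> inner (cfc (\<lambda>t. F t powr p) P x) x / p" by simp
  then show ?thesis using p by (simp add: a_def divide_le_cancel)
qed

section \<open>The Davis--Wielandt radius\<close>

text \<open>Replaces the calculus of the modulus by that of \<open>adj T o\<^sub>L T\<close>, the
  operator for which \<open>mixed_Schwarz\<close> is stated.\<close>

lemma cfc_abs_op:
  fixes T :: "'a::chilbert_space \<Rightarrow>\<^sub>L 'a"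
  assumes "clinear_op T" "continuous_on {0..} h"
  shows "cfc h (abs_op T) = cfc (\<lambda>t. h (sqrt t)) (adj T o\<^sub>L T)"
  unfolding abs_op_def using assms
  by (intro cfc_cfc positive_op_adj_compose) (auto intro!: continuous_intros)

text \<open>Mixed Schwarz, Young and McCarthy are chained here once, to be applied both to
  \<open>T\<close> and to \<open>adj T o\<^sub>L T\<close>.\<close>

lemma cmod_cinner_power2_le:
  fixes T :: "'a::chilbert_space \<Rightarrow>\<^sub>L 'a" and f g :: "real \<Rightarrow> real"
  assumes T: "clinear_op T" and a: "a > 1" and b: "b > 1" and ab: "1 / a + 1 / b = 1"
    and f: "continuous_on {0..} f" "\<And>t. 0 \<le> t \<Longrightarrow> 0 \<le> f t"
    and g: "continuous_on {0..} g" "\<And>t. 0 \<le> t \<Longrightarrow> 0 \<le> g t"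
    and fg: "\<And>t. 0 \<le> t \<Longrightarrow> f t * g t = t"
    and x: "norm x = 1"
  shows "(cmod (cinner (T x) x))\<^sup>2
    \<le> (1 / a) * inner (cfc (\<lambda>t. f t powr (2 * a)) (abs_op T) x) x
      + (1 / b) * inner (cfc (\<lambda>t. g t powr (2 * b)) (abs_op (adj T)) x) x"
proof -
  define A B where "A = adj T o\<^sub>L T" and "B = T o\<^sub>L adj T"
  \<comment> \<open>The square root transfers functions of the modulus to \<open>A\<close> and
    \<open>B\<close>; the squares turn \<open>f (sqrt t) * g (sqrt t) = sqrt t\<close> into
    \<open>F t * G t = t\<close>.\<close>
  define F G where "F t = (f (sqrt t))\<^sup>2" and "G t = (g (sqrt t))\<^sup>2" for t
  have A: "positive_op A" and B: "positive_op B"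
    using positive_op_adj_compose[OF T] positive_op_adj_compose[OF clinear_op_adj[OF T]]
    by (auto simp: A_def B_def adj_adj T)
  have F: "continuous_on {0..} F" and G: "continuous_on {0..} G"
    unfolding F_def G_def
    by (intro continuous_intros continuous_on_compose2[OF f(1)] continuous_on_compose2[OF g(1)]; auto)+
  have FG: "F t * G t = t" if "0 \<le> t" for t
    using fg[of "sqrt t"] that by (simp add: F_def G_def flip: power_mult_distrib)
  \<comment> \<open>Translates the powers of \<open>F\<close> and \<open>G\<close> back to the
    moduli; \<open>(h\<^sup>2) powr r = h powr (2 * r)\<close> is where non-negativity of
    \<open>h\<close> enters.\<close>
  have power: "cfc (\<lambda>t. (h (sqrt t))\<^sup>2 powr r) (adj S o\<^sub>L S) = cfc (\<lambda>t. h t powr (2 * r)) (abs_op S)"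
    if "clinear_op S" "continuous_on {0..} h" "r > 1" and pos: "\<And>t. 0 \<le> t \<Longrightarrow> 0 \<le> h t"
    for h r and S :: "'a \<Rightarrow>\<^sub>L 'a"
  proof -
    have h: "continuous_on {0..} (\<lambda>t. h t powr (2 * r))"
      using that by (intro continuous_on_powr' continuous_intros) auto
    then have "continuous_on {0..} (\<lambda>t. h (sqrt t) powr (2 * r))"
      by (rule continuous_on_compose2) (auto intro: continuous_intros)
    moreover have "(h (sqrt t))\<^sup>2 powr r = h (sqrt t) powr (2 * r)" if "0 \<le> t" for t
      using pos[of "sqrt t"] that
      by (cases "h (sqrt t) = 0") (auto simp: powr_powr simp flip: powr_numeral)
    moreover from calculation have "continuous_on {0..} (\<lambda>t. (h (sqrt t))\<^sup>2 powr r)"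
      by (subst continuous_on_cong) auto
    ultimately have "cfc (\<lambda>t. (h (sqrt t))\<^sup>2 powr r) (adj S o\<^sub>L S)
        = cfc (\<lambda>t. h (sqrt t) powr (2 * r)) (adj S o\<^sub>L S)"
      by (intro cfc_cong positive_op_adj_compose \<open>clinear_op S\<close>)
    then show ?thesis using cfc_abs_op[OF \<open>clinear_op S\<close> h] by simp
  qed
  define z where "z = cinner (T x) x"
  \<comment> \<open>\<open>mixed_Schwarz\<close> controls only the real inner product. Rotating the
    second argument by the phase of \<open>z\<close> makes that real part equal to
    \<open>cmod z\<close>.\<close>
  define \<omega> where "\<omega> = sgn z"
  define c d where "c = inner (cfc F A x) x" and "d = inner (cfc G B x) x"
  have c: "c \<ge> 0" unfolding c_def by (rule positive_opD(3)[OF positive_op_cfc[OF A F]]) (simp add: F_def)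
  have d: "d \<ge> 0" unfolding d_def by (rule positive_opD(3)[OF positive_op_cfc[OF B G]]) (simp add: G_def)
  have "(cmod z)\<^sup>2 \<le> c * d"
  proof (cases "z = 0")
    case False
    have w: "\<omega> * cnj \<omega> = 1"
      unfolding complex_norm_square[symmetric] using False by (simp add: \<omega>_def norm_sgn)
    have "z = \<omega> * of_real (cmod z)" using False by (simp add: \<omega>_def sgn_eq)
    have "inner (T x) (\<omega> *\<^sub>C x) = Re (cnj \<omega> * z)"
      by (simp add: inner_eq_Re_cinner cinner_scaleC_right z_def)
    also have "cnj \<omega> * z = of_real (cmod z)"
      using w \<open>z = \<omega> * of_real (cmod z)\<close> by (metis mult.assoc mult.commute mult_1)
    finally have "(cmod z)\<^sup>2 = (inner (T x) (\<omega> *\<^sub>C x))\<^sup>2" by simp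
    also have "\<dots> \<le> c * inner (cfc G B (\<omega> *\<^sub>C x)) (\<omega> *\<^sub>C x)"
      unfolding A_def B_def c_def by (rule mixed_Schwarz[OF T F _ G _ FG]) (auto simp: F_def G_def)
    \<comment> \<open>The rotation does not affect this quadratic form, because
      \<open>cfc G B\<close> is complex-linear and \<open>\<omega>\<close> has modulus 1.\<close>
    also have "inner (cfc G B (\<omega> *\<^sub>C x)) (\<omega> *\<^sub>C x) = Re (\<omega> * cnj \<omega> * cinner (cfc G B x) x)"
      using cfc_clinear_symmetric(1)[OF B G]
      by (simp add: inner_eq_Re_cinner clinear_op_def cinner_scaleC_left cinner_scaleC_right mult_ac)
    also have "\<dots> = d" unfolding w by (simp add: d_def inner_eq_Re_cinner)
    finally show ?thesis .
  qed (use c d in simp)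
  also have "c * d \<le> c powr a / a + d powr b / b"
    by (rule Youngs_inequality[OF a b ab c d])
  also have "\<dots> \<le> inner (cfc (\<lambda>t. F t powr a) A x) x / a + inner (cfc (\<lambda>t. G t powr b) B x) x / b"
    unfolding c_def d_def using a b
    by (intro add_mono divide_right_mono McCarthy_inequality[OF A F _ a x] McCarthy_inequality[OF B G _ b x])
      (auto simp: F_def G_def)
  also have "cfc (\<lambda>t. F t powr a) A = cfc (\<lambda>t. f t powr (2 * a)) (abs_op T)"
    unfolding F_def A_def by (rule power[OF T f(1) a f(2)])
  also have "cfc (\<lambda>t. G t powr b) B = cfc (\<lambda>t. g t powr (2 * b)) (abs_op (adj T))"
    using power[OF clinear_op_adj[OF T] g(1) b g(2)] by (simp add: G_def B_def adj_adj T)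
  finally show ?thesis by (simp add: z_def)
qed

theorem theorem2p13:
  fixes T :: "'a::chilbert_space \<Rightarrow>\<^sub>L 'a"
    and \<alpha> \<beta> :: "nat \<Rightarrow> real"
    and f g :: "nat \<Rightarrow> real \<Rightarrow> real"
  assumes "clinear_op T"
    and "\<And>i. i \<in> {1, 2} \<Longrightarrow> \<alpha> i > 1"
    and "\<And>i. i \<in> {1, 2} \<Longrightarrow> \<beta> i > 1"
    and "\<And>i. i \<in> {1, 2} \<Longrightarrow> 1 / \<alpha> i + 1 / \<beta> i = 1"
    and "\<And>i. i \<in> {1, 2} \<Longrightarrow> continuous_on {0..} (f i)"
    and "\<And>i. i \<in> {1, 2} \<Longrightarrow> continuous_on {0..} (g i)"
    and "\<And>i t. i \<in> {1, 2} \<Longrightarrow> t \<ge> 0 \<Longrightarrow> f i t \<ge> 0"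
    and "\<And>i t. i \<in> {1, 2} \<Longrightarrow> t \<ge> 0 \<Longrightarrow> g i t \<ge> 0"
    and "\<And>i t. i \<in> {1, 2} \<Longrightarrow> t \<ge> 0 \<Longrightarrow> f i t * g i t = t"
  shows "(dw T)\<^sup>2 \<le> norm
    ( (1 / \<alpha> 1) *\<^sub>R cfc (\<lambda>t. f 1 t powr (2 * \<alpha> 1)) (abs_op T)
    + (1 / \<beta> 1) *\<^sub>R cfc (\<lambda>t. g 1 t powr (2 * \<beta> 1)) (abs_op (adj T))
    + (1 / \<alpha> 2) *\<^sub>R cfc (\<lambda>t. f 2 t powr (2 * \<alpha> 2)) (abs_op (adj T o\<^sub>L T))
    + (1 / \<beta> 2) *\<^sub>R cfc (\<lambda>t. g 2 t powr (2 * \<beta> 2)) (abs_op (adj T o\<^sub>L T)))"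
    (is "_ \<le> norm ?N")
proof -
  note T = assms(1)
  define A where "A = adj T o\<^sub>L T"
  have A: "positive_op A" unfolding A_def by (rule positive_op_adj_compose[OF T])
  \<comment> \<open>Self-adjointness of \<open>A\<close> makes both terms of the second application
    refer to the same modulus \<open>abs_op A\<close>.\<close>
  have adj_A: "adj A = A"
    by (rule adj_eqI) (use A in \<open>auto simp: positive_op_def symmetric_op_def\<close>)
  have bound: "(cmod (cinner (T x) x))\<^sup>2 + norm (T x) ^ 4 \<le> norm ?N" if x: "norm x = 1" for x
  proof -
    have "cinner (A x) x = of_real ((norm (T x))\<^sup>2)"
    proof -
      have "cinner x (A x) = cinner (T x) (T x)"
        using inner_adjoint_imp_cinner[OF T inner_adj[OF T]] by (simp add: A_def)
      then show ?thesis by (metis cinner_commute cinner_self complex_cnj_complex_of_real)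
    qed
    then have "norm (T x) ^ 4 = (cmod (cinner (A x) x))\<^sup>2"
      by (simp add: norm_power flip: power_mult)
    also have "\<dots> \<le> (1 / \<alpha> 2) * inner (cfc (\<lambda>t. f 2 t powr (2 * \<alpha> 2)) (abs_op A) x) x
      + (1 / \<beta> 2) * inner (cfc (\<lambda>t. g 2 t powr (2 * \<beta> 2)) (abs_op A) x) x"
      using cmod_cinner_power2_le[OF positive_opD(1)[OF A], of "\<alpha> 2" "\<beta> 2" "f 2" "g 2" x] assms(2-) x
      by (simp add: adj_A)
    moreover have "(cmod (cinner (T x) x))\<^sup>2
      \<le> (1 / \<alpha> 1) * inner (cfc (\<lambda>t. f 1 t powr (2 * \<alpha> 1)) (abs_op T) x) x
      + (1 / \<beta> 1) * inner (cfc (\<lambda>t. g 1 t powr (2 * \<beta> 1)) (abs_op (adj T)) x) x"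
      using cmod_cinner_power2_le[OF T, of "\<alpha> 1" "\<beta> 1" "f 1" "g 1" x] assms(2-) x by simp
    ultimately have "(cmod (cinner (T x) x))\<^sup>2 + norm (T x) ^ 4 \<le> inner (?N x) x"
      unfolding A_def by (simp only: blinfun.add_left blinfun.scaleR_left inner_add_left inner_scaleR_left)
    also have "\<dots> \<le> norm ?N" using inner_blinfun_le_norm[of ?N x] x by simp
    finally show ?thesis .
  qed
  \<comment> \<open>The inserted \<open>0\<close> obeys the same bound. It keeps the set nonempty
    when there are no unit vectors, and its membership gives \<open>0 \<le> dw T\<close>, needed for
    squaring.\<close>
  have ub: "s \<le> sqrt (norm ?N)"
    if "s \<in> insert 0 {sqrt ((cmod (cinner (T x) x))\<^sup>2 + norm (T x) ^ 4) | x. norm x = 1}" for s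
    using that bound by auto
  have "dw T \<le> sqrt (norm ?N)"
    unfolding dw_def by (rule cSup_least) (use ub in blast)+
  moreover have "0 \<le> dw T"
    unfolding dw_def using ub by (intro cSup_upper bdd_aboveI) blast+
  ultimately have "(dw T)\<^sup>2 \<le> (sqrt (norm ?N))\<^sup>2" by (rule power_mono)
  then show ?thesis by simp
qed

end
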